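(* Let $M=(E,\mathcal{F})$ be a matroid and $k$ a field of characteristic zero. The tropical hypersurface $V_{\rm trop}(\Phi_M)\subset\mathbb{R}^E$ is a subcomplex of the fan $-G(J_M)$ (that is, the set $V_{\rm trop}(\Phi_M)$ is the union of the cones of a subcomplex of $-G(J_M)$), where $G(J_M)$ is the Gröbner fan of the ideal $J_M$.
   Context: A matroid $M=(E,\mathcal{F})$ is a finite set $E$ with its system $\mathcal{F}\subset 2^E$ of independent sets; $\mathcal{B}$ is the set of bases, and $S\sim T$ means that $S,T\subset E$ have the same matroid closure. $\Phi_M=\sum_{B\in\mathcal{B}}\prod_{b\in B}x_b$. The tropical hypersurface $V_{\rm trop}(\Phi_M)\subset\mathbb{R}^E$ is the locus where the piecewise linear function $\operatorname{trop}(\Phi_M)=\max(\sum_{e\in B}x_e\mid B\in\mathcal{B})$ is not smooth. Let $Q=k[X_e\mid e\in E]$, $X_S=\prod_{e\in S}X_e$, and let $J_M\subset Q$ be the ideal generated by $\{X_e^2\mid e\in E\}\cup\{X_S\mid S\notin\mathcal{F}\}\cup\{X_A-X_{A'}\mid A,A'\in\mathcal{F},A\sim A'\}$. Gröbner fan: for a homogeneous ideal $I\subset Q$ and $\omega\in\mathbb{R}^E$, $\operatorname{in}_\omega(f)$ is the sum of the terms of $f$ of maximal $\omega$-weight and $\operatorname{in}_\omega(I)=(\operatorname{in}_\omega(f)\mid f\in I,f\ne0)$. The sets $C(\omega)=\operatorname{closure}\{\lambda\in\mathbb{R}^E\mid\operatorname{in}_\lambda(I)=\operatorname{in}_\omega(I)\}$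 are polyhedral cones, which form the Gröbner fan $G(I)$. For a fan $\Sigma$, $-\Sigma=\{-\sigma\mid\sigma\in\Sigma\}$. *)

theory Defs
  imports
    "HOL-Analysis.Analysis"
    "HOL-Algebra.Ideal"
    "HOL-Library.Poly_Mapping"
begin

section \<open>Matroids\<close>

locale matroid =
  fixes E :: "'e set" and F :: "'e set set"
  assumes finite_ground: "finite E"
    and indep_subset_ground: "F \<subseteq> Pow E"
    and empty_indep: "{} \<in> F"
    and hereditary: "\<And>A B. B \<in> F \<Longrightarrow> A \<subseteq> B \<Longrightarrow> A \<in> F"
    and augmentation: "\<And>A B. A \<in> F \<Longrightarrow> B \<in> F \<Longrightarrow> card A < card B
                         \<Longrightarrow> \<exists>b\<in>B - A. insert b A \<in> F"

definition bases :: "'e set set \<Rightarrow> 'e set set" where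
  "bases F = {B \<in> F. \<forall>B'\<in>F. B \<subseteq> B' \<longrightarrow> B' = B}"

definition matroid_rank :: "'e set set \<Rightarrow> 'e set \<Rightarrow> nat" where
  "matroid_rank F S = Max (card ` {I \<in> F. I \<subseteq> S})"

definition matroid_closure :: "'e set \<Rightarrow> 'e set set \<Rightarrow> 'e set \<Rightarrow> 'e set" where
  "matroid_closure E F S = {e \<in> E. matroid_rank F (insert e S) = matroid_rank F S}"


section \<open>The polynomial ring in the variables indexed by E\<close>

text \<open>A monomial is a finitely supported exponent vector, a polynomial a finitely supported
  family of coefficients; the ring operations are those of the type of finitely supported
  functions (convolution product). The ring of polynomials in the variables indexed by \<open>E\<close>
  is a subring of this type, presented as a ring record so that \<^const>\<open>genideal\<close> can be
  used for generated ideals.\<close>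

type_synonym ('e, 'k) mpoly = "('e \<Rightarrow>\<^sub>0 nat) \<Rightarrow>\<^sub>0 'k"

definition mpoly_ring :: "'e set \<Rightarrow> ('e, 'k::comm_ring_1) mpoly ring" where
  "mpoly_ring E =
     \<lparr>carrier = {p. \<forall>m\<in>Poly_Mapping.keys p. Poly_Mapping.keys m \<subseteq> E}, mult = (*), one = 1, zero = 0, add = (+)\<rparr>"

definition X :: "'e \<Rightarrow> ('e, 'k::comm_ring_1) mpoly" where
  "X e = Poly_Mapping.single (Poly_Mapping.single e 1) 1"

definition XS :: "'e set \<Rightarrow> ('e, 'k::comm_ring_1) mpoly" where
  "XS S = (\<Prod>e\<in>S. X e)"

definition basis_poly :: "'e set set \<Rightarrow> ('e, 'k::comm_ring_1) mpoly" where
  "basis_poly F = (\<Sum>B\<in>bases F. XS B)"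

definition J_ideal :: "'e set \<Rightarrow> 'e set set \<Rightarrow> ('e, 'k::comm_ring_1) mpoly set" where
  "J_ideal E F = genideal (mpoly_ring E)
     ({(X e)\<^sup>2 | e. e \<in> E}
      \<union> {XS S | S. S \<subseteq> E \<and> S \<notin> F}
      \<union> {XS A - XS A' | A A'. A \<in> F \<and> A' \<in> F \<and> matroid_closure E F A = matroid_closure E F A'})"


section \<open>Weights and the tropical hypersurface\<close>

text \<open>The space of real vectors indexed by \<open>E\<close>, as a coordinate subspace of \<open>real ^ 'e\<close>; this
  allows \<open>E\<close> to be an arbitrary, possibly empty, finite set.\<close>

definition RE :: "'e::finite set \<Rightarrow> (real ^ 'e) set" where
  "RE E = {w. \<forall>e. e \<notin> E \<longrightarrow> w $ e = 0}"

definition weight :: "real ^ 'e \<Rightarrow> ('e::finite \<Rightarrow>\<^sub>0 nat) \<Rightarrow> real" where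
  "weight w m = (\<Sum>e\<in>Poly_Mapping.keys m. real (Poly_Mapping.lookup m e) * w $ e)"

text \<open>Coefficients carry the trivial valuation, so only the support of the polynomial matters.\<close>

definition trop :: "('e::finite, 'k::comm_ring_1) mpoly \<Rightarrow> real ^ 'e \<Rightarrow> real" where
  "trop f w = Max (weight w ` Poly_Mapping.keys f)"

text \<open>Smoothness means smoothness of class C-infinity: near \<open>w\<close> there is a family \<open>D\<close> of iterated
  partial derivatives (indexed by the list of coordinate directions), all of them differentiable.\<close>

definition smooth_at :: "'e::finite set \<Rightarrow> (real ^ 'e \<Rightarrow> real) \<Rightarrow> real ^ 'e \<Rightarrow> bool" where
  "smooth_at E f w \<longleftrightarrow>
     (\<exists>U D. openin (top_of_set (RE E)) U \<and> w \<in> U \<and> (\<forall>x\<in>U. D [] x = f x) \<and>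
        (\<forall>es\<in>lists E. \<forall>x\<in>U.
           (D es has_derivative (\<lambda>h. \<Sum>e\<in>E. h $ e * D (e # es) x)) (at x within U)))"

definition trop_hypersurface :: "'e::finite set \<Rightarrow> ('e, 'k::comm_ring_1) mpoly \<Rightarrow> (real ^ 'e) set"
  where "trop_hypersurface E f = {w \<in> RE E. \<not> smooth_at E (trop f) w}"


section \<open>The Groebner fan\<close>

definition initial_form :: "real ^ 'e \<Rightarrow> ('e::finite, 'k::comm_ring_1) mpoly \<Rightarrow> ('e, 'k) mpoly" where
  "initial_form w f =
     (\<Sum>m\<in>{m \<in> Poly_Mapping.keys f. \<forall>m'\<in>Poly_Mapping.keys f. weight w m' \<le> weight w m}. Poly_Mapping.single m (Poly_Mapping.lookup f m))"

definition initial_ideal ::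
    "'e::finite set \<Rightarrow> real ^ 'e \<Rightarrow> ('e, 'k::comm_ring_1) mpoly set \<Rightarrow> ('e, 'k) mpoly set" where
  "initial_ideal E w I = genideal (mpoly_ring E) {initial_form w f | f. f \<in> I \<and> f \<noteq> 0}"

definition groebner_cone ::
    "'e::finite set \<Rightarrow> ('e, 'k::comm_ring_1) mpoly set \<Rightarrow> real ^ 'e \<Rightarrow> (real ^ 'e) set" where
  "groebner_cone E I w = closure {l \<in> RE E. initial_ideal E l I = initial_ideal E w I}"

definition groebner_fan ::
    "'e::finite set \<Rightarrow> ('e, 'k::comm_ring_1) mpoly set \<Rightarrow> (real ^ 'e) set set" where
  "groebner_fan E I = groebner_cone E I ` RE E"

definition neg_fan :: "(real ^ 'e) set set \<Rightarrow> (real ^ 'e::finite) set set" where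
  "neg_fan \<Sigma> = (\<lambda>\<sigma>. uminus ` \<sigma>) ` \<Sigma>"

text \<open>The empty set counts as a face for \<open>face_of\<close>, but not as a face of a cone in a fan.\<close>

definition subcomplex :: "(real ^ 'e) set set \<Rightarrow> (real ^ 'e::finite) set set \<Rightarrow> bool" where
  "subcomplex C \<Sigma> \<longleftrightarrow>
     C \<subseteq> \<Sigma> \<and> (\<forall>\<sigma>\<in>C. \<forall>\<tau>. \<tau> face_of \<sigma> \<and> \<tau> \<noteq> {} \<longrightarrow> \<tau> \<in> C)"


section \<open>Consistency of the encodings\<close>

lemma cring_mpoly_ring: "cring (mpoly_ring E :: ('e, 'k::comm_ring_1) mpoly ring)"
proof -
  let ?C = "{p :: ('e, 'k) mpoly. \<forall>m\<in>Poly_Mapping.keys p. Poly_Mapping.keys m \<subseteq> E}"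
  have add: "p + q \<in> ?C" if "p \<in> ?C" "q \<in> ?C" for p q
    using that Poly_Mapping.keys_add[of p q] by blast
  have mult: "p * q \<in> ?C" if "p \<in> ?C" "q \<in> ?C" for p q
  proof -
    have "Poly_Mapping.keys m \<subseteq> E" if m: "m \<in> Poly_Mapping.keys (p * q)" for m
    proof -
      obtain a b where "a \<in> Poly_Mapping.keys p" "b \<in> Poly_Mapping.keys q" "m = a + b"
        using m keys_mult[of p q] by blast
      then show ?thesis
        using \<open>p \<in> ?C\<close> \<open>q \<in> ?C\<close> Poly_Mapping.keys_add[of a b] by blast
    qed
    then show ?thesis by blast
  qed
  have inverse: "\<exists>q\<in>?C. p + q = 0" if "p \<in> ?C" for p
    using that by (intro bexI[of _ "- p"]) simp_all
  show ?thesis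
  proof (intro cringI abelian_groupI comm_monoidI)
    fix p :: "('e, 'k) mpoly" assume "p \<in> carrier (mpoly_ring E)"
    then show "\<exists>q\<in>carrier (mpoly_ring E). q \<oplus>\<^bsub>mpoly_ring E\<^esub> p = \<zero>\<^bsub>mpoly_ring E\<^esub>"
      using inverse[of p] by (simp add: mpoly_ring_def add.commute)
  next
    fix p q :: "('e, 'k) mpoly"
    assume "p \<in> carrier (mpoly_ring E)" "q \<in> carrier (mpoly_ring E)"
    then show "p \<oplus>\<^bsub>mpoly_ring E\<^esub> q \<in> carrier (mpoly_ring E)"
      and "p \<otimes>\<^bsub>mpoly_ring E\<^esub> q \<in> carrier (mpoly_ring E)"
      using add[of p q] mult[of p q] by (simp_all add: mpoly_ring_def)
  qed (simp_all add: mpoly_ring_def algebra_simps)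
qed

lemma XS_eq_single:
  "finite S \<Longrightarrow> (XS S :: ('e, 'k::comm_ring_1) mpoly)
     = Poly_Mapping.single (\<Sum>e\<in>S. Poly_Mapping.single e 1) 1"
  by (induction S rule: finite_induct) (simp_all add: XS_def X_def mult_single)

lemma keys_basis_poly:
  assumes "matroid E F"
  shows "Poly_Mapping.keys (basis_poly F :: ('e, 'k::comm_ring_1) mpoly)
     = (\<lambda>B. \<Sum>e\<in>B. Poly_Mapping.single e 1) ` bases F"
proof -
  interpret matroid E F by fact
  let ?m = "\<lambda>B :: 'e set. \<Sum>e\<in>B. Poly_Mapping.single e (1::nat)"
  have fin: "finite B" if "B \<in> bases F" for B
    using that indep_subset_ground finite_ground by (auto simp: bases_def intro: finite_subset)
  have fin_bases: "finite (bases F)"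
    by (rule finite_subset[of _ "Pow E"])
       (use indep_subset_ground finite_ground in \<open>auto simp: bases_def\<close>)
  have lookup_m: "Poly_Mapping.lookup (?m B) e = (if e \<in> B then 1 else 0)" if "finite B" for B e
    using that by (simp add: lookup_sum lookup_single when_def)
  have inj: "inj_on ?m (bases F)"
  proof (rule inj_onI)
    fix B B' assume "B \<in> bases F" "B' \<in> bases F" "?m B = ?m B'"
    then have "(if e \<in> B then 1 else 0) = (if e \<in> B' then 1 else (0::nat))" for e
      using lookup_m[OF fin] by metis
    then show "B = B'" by (auto simp: set_eq_iff split: if_splits) (metis zero_neq_one)+
  qed
  have poly: "(basis_poly F :: ('e, 'k) mpoly) = (\<Sum>m\<in>?m ` bases F. Poly_Mapping.single m 1)"
    unfolding basis_poly_def sum.reindex[OF inj] by (rule sum.cong) (simp_all add: XS_eq_single fin)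
  have "Poly_Mapping.lookup (basis_poly F :: ('e, 'k) mpoly) m = (if m \<in> ?m ` bases F then 1 else 0)" for m
    unfolding poly using fin_bases by (simp add: lookup_sum lookup_single when_def)
  then show ?thesis by (auto simp: in_keys_iff split: if_splits)
qed

lemma trop_basis_poly:
  fixes E :: "'e::finite set"
  assumes "matroid E F"
  shows "trop (basis_poly F :: ('e, 'k::comm_ring_1) mpoly) w = Max {\<Sum>e\<in>B. w $ e | B. B \<in> bases F}"
proof -
  have keys: "Poly_Mapping.keys (\<Sum>e\<in>B. Poly_Mapping.single e (1::nat)) = B" for B :: "'e set"
    by (auto simp: in_keys_iff lookup_sum lookup_single when_def split: if_splits)
  have "weight w (\<Sum>e\<in>B. Poly_Mapping.single e 1) = (\<Sum>e\<in>B. w $ e)" for B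
    unfolding weight_def keys by (simp add: lookup_sum lookup_single when_def)
  then show ?thesis
    unfolding trop_def keys_basis_poly[OF assms] by (simp add: image_image setcompr_eq_image)
qed

end

theory Submission
  imports Defs
begin

text \<open>For a weight \<open>w\<close>, let \<open>N\<close> be the family of independent sets that have minimal weight among
  all independent sets with the same closure. The initial ideal of \<open>J_M\<close> with respect to \<open>w\<close> is
  spanned by all monomials other than the \<open>X_A\<close> with \<open>A\<close> in \<open>N\<close>, and by the differences
  \<open>X_A - X_B\<close> with \<open>A, B\<close> in \<open>N\<close> of the same closure; in particular it determines \<open>N\<close>
  and is determined by it. Hence the Groebner cone of \<open>w\<close> consists of the weights whose family
  contains \<open>N\<close>, and its nonempty faces are cones of the same kind, as one sees from a point in the
  relative interior of the face. Finally, the maximum over the bases is not smooth at \<open>w\<close> iff it is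
  attained twice, that is, iff the family of \<open>- w\<close> contains two bases. This condition passes to
  larger families, so it cuts out a union of negated cones that is closed under taking faces.\<close>

section \<open>Fans of minimizers\<close>

text \<open>Minimality is taken separately in each fibre of \<open>\<kappa>\<close>. In the
  application \<open>\<kappa>\<close> is the matroid closure and \<open>\<phi>\<close> the weight of
  a set.\<close>

definition minimizers :: "'a set \<Rightarrow> ('a \<Rightarrow> 'b) \<Rightarrow> ('a \<Rightarrow> real) \<Rightarrow> 'a set" where
  "minimizers F \<kappa> \<phi> = {a \<in> F. \<forall>b\<in>F. \<kappa> b = \<kappa> a \<longrightarrow> \<phi> a \<le> \<phi> b}"

lemma ex_minimizer:
  assumes "finite F" "a \<in> F"
  shows "\<exists>b\<in>minimizers F \<kappa> \<phi>. \<kappa> b = \<kappa> a"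
proof -
  let ?S = "{b \<in> F. \<kappa> b = \<kappa> a}"
  have S: "finite ?S" "?S \<noteq> {}" using assms by auto
  have "arg_min_on \<phi> ?S \<in> minimizers F \<kappa> \<phi>"
    using arg_min_least[OF S, of _ \<phi>] arg_min_if_finite(1)[OF S, of \<phi>] by (auto simp: minimizers_def)
  then show ?thesis using arg_min_if_finite(1)[OF S] by blast
qed

lemma minimizers_eq_value:
  assumes "a \<in> minimizers F \<kappa> \<phi>" "b \<in> minimizers F \<kappa> \<phi>" "\<kappa> a = \<kappa> b"
  shows "\<phi> a = \<phi> b"
  using assms by (auto simp: minimizers_def intro: antisym)

lemma minimizersI_le:
  assumes "a \<in> minimizers F \<kappa> \<phi>" "b \<in> F" "\<kappa> a = \<kappa> b" "\<phi> b \<le> \<phi> a"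
  shows "b \<in> minimizers F \<kappa> \<phi>"
  using assms by (fastforce simp: minimizers_def)

text \<open>Prepares the use of \<open>face_ofD\<close>: a segment from \<open>l\<close> prolonged a
  little past \<open>v\<close> has \<open>v\<close> strictly inside it, with coefficient
  \<open>\<epsilon> / (1 + \<epsilon>)\<close> at \<open>l\<close>.\<close>

lemma mem_open_segment_extension:
  fixes l v :: "'v::real_vector"
  assumes "\<epsilon> > 0" "l \<noteq> v"
  shows "v \<in> open_segment (v - \<epsilon> *\<^sub>R (l - v)) l"
proof -
  have "v = (1 - \<epsilon> / (1 + \<epsilon>)) *\<^sub>R (v - \<epsilon> *\<^sub>R (l - v)) + (\<epsilon> / (1 + \<epsilon>)) *\<^sub>R l"
  proof -
    have "(1 + \<epsilon>) *\<^sub>R ((1 - \<epsilon> / (1 + \<epsilon>)) *\<^sub>R (v - \<epsilon> *\<^sub>R (l - v)) + (\<epsilon> / (1 + \<epsilon>)) *\<^sub>R l)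
        = ((1 + \<epsilon>) * (1 - \<epsilon> / (1 + \<epsilon>))) *\<^sub>R (v - \<epsilon> *\<^sub>R (l - v)) + ((1 + \<epsilon>) * (\<epsilon> / (1 + \<epsilon>))) *\<^sub>R l"
      by (simp add: scaleR_add_right)
    also have "(1 + \<epsilon>) * (1 - \<epsilon> / (1 + \<epsilon>)) = 1" using assms by (simp add: field_simps)
    also have "(1 + \<epsilon>) * (\<epsilon> / (1 + \<epsilon>)) = \<epsilon>" using assms by (simp add: field_simps)
    also have "1 *\<^sub>R (v - \<epsilon> *\<^sub>R (l - v)) + \<epsilon> *\<^sub>R l = (1 + \<epsilon>) *\<^sub>R v" by (simp add: algebra_simps)
    finally show ?thesis using assms by (simp only: scaleR_cancel_left) auto
  qed
  moreover have "v - \<epsilon> *\<^sub>R (l - v) \<noteq> l"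
  proof
    assume "v - \<epsilon> *\<^sub>R (l - v) = l"
    then have "(1 + \<epsilon>) *\<^sub>R (l - v) = 0" by (simp add: algebra_simps)
    with assms show False by simp
  qed
  moreover have "0 < \<epsilon> / (1 + \<epsilon>)" "\<epsilon> / (1 + \<epsilon>) < 1" using assms by (simp_all add: field_simps)
  ultimately show ?thesis unfolding in_segment by blast
qed

text \<open>The geometry of the cones, isolated from the matroid: each element of \<open>F\<close>
  gives a linear function of the weight \<open>v\<close>, and \<open>V\<close> is the space of
  weights, later \<open>RE E\<close>.\<close>

locale minimizer_fan =
  fixes F :: "'a set" and \<kappa> :: "'a \<Rightarrow> 'b" and \<phi> :: "'v::euclidean_space \<Rightarrow> 'a \<Rightarrow> real"
    and V :: "'v set"
  assumes finite: "finite F" and linear: "\<And>a. linear (\<lambda>v. \<phi> v a)" and subspace: "subspace V"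
begin

abbreviation Min_at :: "'v \<Rightarrow> 'a set" where
  "Min_at v \<equiv> minimizers F \<kappa> (\<phi> v)"

definition min_cone :: "'v \<Rightarrow> 'v set" where
  "min_cone v = {l \<in> V. Min_at v \<subseteq> Min_at l}"

lemma phi_add: "\<phi> (u + v) a = \<phi> u a + \<phi> v a"
  and phi_scale: "\<phi> (t *\<^sub>R v) a = t * \<phi> v a"
  and phi_diff: "\<phi> (u - v) a = \<phi> u a - \<phi> v a"
  using linear_add[OF linear] linear_scale[OF linear] linear_diff[OF linear] by auto

text \<open>In every fibre a minimizer for \<open>v\<close> is one for \<open>l\<close> as well, so
  both parts of the combination reach their minima together. A minimizer of the combination must
  then attain the minimum for \<open>v\<close>, because the coefficient \<open>t\<close> is
  positive.\<close>

lemma Min_at_convex_combination: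
  assumes "Min_at v \<subseteq> Min_at l" "0 < t" "t \<le> 1"
  shows "Min_at ((1 - t) *\<^sub>R l + t *\<^sub>R v) = Min_at v"
proof (intro equalityI subsetI)
  fix a assume a: "a \<in> Min_at ((1 - t) *\<^sub>R l + t *\<^sub>R v)"
  then have "a \<in> F" by (simp add: minimizers_def)
  obtain b where b: "b \<in> Min_at v" "\<kappa> b = \<kappa> a"
    using ex_minimizer[OF finite \<open>a \<in> F\<close>] by blast
  have "\<phi> l b \<le> \<phi> l a" "b \<in> F" using b assms(1) \<open>a \<in> F\<close> by (auto simp: minimizers_def)
  moreover have "(1 - t) * \<phi> l a + t * \<phi> v a \<le> (1 - t) * \<phi> l b + t * \<phi> v b"
    using a b \<open>b \<in> F\<close> by (auto simp: minimizers_def phi_add phi_scale)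
  moreover have "(1 - t) * \<phi> l b \<le> (1 - t) * \<phi> l a"
    using calculation(1) assms by (intro mult_left_mono) auto
  ultimately have "\<phi> v a \<le> \<phi> v b" using \<open>0 < t\<close> by (smt (verit) mult_le_cancel_left)
  with b \<open>a \<in> F\<close> show "a \<in> Min_at v" using minimizersI_le[of b F \<kappa> "\<phi> v" a] by simp
next
  fix a assume "a \<in> Min_at v"
  with assms show "a \<in> Min_at ((1 - t) *\<^sub>R l + t *\<^sub>R v)"
    by (fastforce simp: minimizers_def phi_add phi_scale intro!: add_mono mult_left_mono)
qed

lemma closed_min_cone: "closed (min_cone v)"
proof -
  have "min_cone v = V \<inter> (\<Inter>a\<in>Min_at v. \<Inter>b\<in>{b \<in> F. \<kappa> b = \<kappa> a}. {l. \<phi> l a \<le> \<phi> l b})"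
    by (auto simp: min_cone_def minimizers_def)
  moreover have "closed {l. \<phi> l a \<le> \<phi> l b}" for a b
    using linear by (intro closed_Collect_le linear_continuous_on linear_conv_bounded_linear[THEN iffD1])
  ultimately show ?thesis
    using closed_subspace[OF subspace] by (auto intro!: closed_INT)
qed

text \<open>Any step from \<open>l\<close> in the cone towards \<open>v\<close> yields exactly the
  family of \<open>v\<close>, so \<open>l\<close> is a limit of such weights. The other inclusion
  holds because the cone is closed.\<close>

lemma closure_Min_at_eq:
  assumes "v \<in> V"
  shows "closure {l \<in> V. Min_at l = Min_at v} = min_cone v"
proof (intro equalityI closure_minimal closed_min_cone subsetI)
  fix l assume l: "l \<in> min_cone v"
  let ?S = "{l \<in> V. Min_at l = Min_at v}"
  have "((\<lambda>t. (1 - t) *\<^sub>R l + t *\<^sub>R v) \<longlongrightarrow> (1 - 0) *\<^sub>R l + 0 *\<^sub>R v) (at_right (0::real))"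
    by (intro tendsto_intros)
  moreover have "\<forall>\<^sub>F t in at_right (0::real). (1 - t) *\<^sub>R l + t *\<^sub>R v \<in> closure ?S"
    unfolding eventually_at_right_field
  proof (intro exI[of _ 1] conjI allI impI)
    fix t :: real assume "0 < t" "t < 1"
    then show "(1 - t) *\<^sub>R l + t *\<^sub>R v \<in> closure ?S"
      using l assms subspace Min_at_convex_combination[of v l t]
      by (intro closure_subset[THEN subsetD]) (auto simp: min_cone_def subspace_add subspace_scale)
  qed simp
  ultimately show "l \<in> closure ?S"
    by (intro Lim_in_closed_set[of "closure ?S" _ "at_right 0"]) simp_all
qed (auto simp: min_cone_def)

lemma min_cone_antimono: "Min_at u \<subseteq> Min_at v \<Longrightarrow> min_cone v \<subseteq> min_cone u"
  by (auto simp: min_cone_def)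

text \<open>Comparisons that are strict at \<open>v\<close> survive a small step, and there are only
  finitely many of them. Ties at \<open>v\<close> occur between minimizers for \<open>v\<close>;
  these also tie at \<open>l\<close>, hence on the whole line through \<open>l\<close> and
  \<open>v\<close>.\<close>

lemma extend_beyond_face_point:
  assumes "Min_at u \<subseteq> Min_at v" "l \<in> min_cone v" "v \<in> V"
  shows "\<exists>\<epsilon>>0. v - \<epsilon> *\<^sub>R (l - v) \<in> min_cone u"
proof -
  let ?P = "{(a, b) \<in> Min_at u \<times> F. \<kappa> b = \<kappa> a \<and> \<phi> v a < \<phi> v b}"
  have ev: "\<forall>\<^sub>F \<epsilon> in at_right (0::real). \<forall>(a, b)\<in>?P. \<phi> v a - \<epsilon> * (\<phi> l a - \<phi> v a) < \<phi> v b - \<epsilon> * (\<phi> l b - \<phi> v b)"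
  proof (rule eventually_ball_finite)
    show "finite ?P"
      by (rule finite_subset[of _ "F \<times> F"]) (use finite in \<open>auto simp: minimizers_def\<close>)
    show "\<forall>p\<in>?P. \<forall>\<^sub>F \<epsilon> in at_right 0. case p of (a, b) \<Rightarrow>
        \<phi> v a - \<epsilon> * (\<phi> l a - \<phi> v a) < \<phi> v b - \<epsilon> * (\<phi> l b - \<phi> v b)"
    proof clarify
      fix a b assume "\<phi> v a < \<phi> v b"
      moreover have lim: "((\<lambda>\<epsilon>. (\<phi> v b - \<epsilon> * (\<phi> l b - \<phi> v b)) - (\<phi> v a - \<epsilon> * (\<phi> l a - \<phi> v a)))
          \<longlongrightarrow> (\<phi> v b - 0 * (\<phi> l b - \<phi> v b)) - (\<phi> v a - 0 * (\<phi> l a - \<phi> v a))) (at_right (0::real))"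
        by (intro tendsto_intros)
      ultimately show "\<forall>\<^sub>F \<epsilon> in at_right 0. \<phi> v a - \<epsilon> * (\<phi> l a - \<phi> v a) < \<phi> v b - \<epsilon> * (\<phi> l b - \<phi> v b)"
        using order_tendstoD(1)[OF lim, of 0] by simp
    qed
  qed
  then obtain \<epsilon> where \<epsilon>: "\<epsilon> > 0" "\<forall>(a, b)\<in>?P. \<phi> v a - \<epsilon> * (\<phi> l a - \<phi> v a) < \<phi> v b - \<epsilon> * (\<phi> l b - \<phi> v b)"
    unfolding eventually_at_right_field by (meson dense)
  have "v - \<epsilon> *\<^sub>R (l - v) \<in> min_cone u"
    unfolding min_cone_def
  proof (intro CollectI conjI subsetI)
    show "v - \<epsilon> *\<^sub>R (l - v) \<in> V"
      using assms subspace by (simp add: min_cone_def subspace_diff subspace_scale)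
    fix a assume a: "a \<in> Min_at u"
    have "\<phi> (v - \<epsilon> *\<^sub>R (l - v)) a \<le> \<phi> (v - \<epsilon> *\<^sub>R (l - v)) b" if b: "b \<in> F" "\<kappa> b = \<kappa> a" for b
    proof (cases "\<phi> v a < \<phi> v b")
      case True
      then show ?thesis using \<epsilon> a b by (force simp: phi_diff phi_scale)
    next
      case False
      then have "b \<in> Min_at v" "a \<in> Min_at v"
        using a b assms(1) by (auto intro: minimizersI_le[of a])
      then have "\<phi> v a = \<phi> v b" "\<phi> l a = \<phi> l b"
        using assms(2) b minimizers_eq_value[of a F \<kappa> _ b] by (auto simp: min_cone_def)
      then show ?thesis by (simp add: phi_diff phi_scale)
    qed
    with a show "a \<in> Min_at (v - \<epsilon> *\<^sub>R (l - v))" by (auto simp: minimizers_def)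
  qed
  with \<epsilon> show ?thesis by blast
qed

text \<open>A relative interior point \<open>v\<close> determines the face. A point \<open>l\<close>
  of its cone lies in \<open>\<tau>\<close>, because the segment from \<open>l\<close> can be
  prolonged past \<open>v\<close> inside \<open>min_cone u\<close>, so that \<open>v\<close> is
  strictly between two points of that cone.\<close>

lemma face_of_min_cone:
  assumes face: "\<tau> face_of min_cone u" and "\<tau> \<noteq> {}"
  shows "\<exists>v\<in>min_cone u. \<tau> = min_cone v"
proof -
  have "convex \<tau>" using face by (rule face_of_imp_convex)
  then obtain v where v: "v \<in> rel_interior \<tau>"
    using \<open>\<tau> \<noteq> {}\<close> rel_interior_eq_empty by blast
  have "v \<in> \<tau>" using v rel_interior_subset by blast
  then have vu: "v \<in> min_cone u" using face face_of_imp_subset by blast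
  then have "v \<in> V" and uv: "Min_at u \<subseteq> Min_at v" by (auto simp: min_cone_def)
  have "l \<in> \<tau>" if l: "l \<in> min_cone v" for l
  proof (cases "l = v")
    case False
    obtain \<epsilon> where \<epsilon>: "\<epsilon> > 0" "v - \<epsilon> *\<^sub>R (l - v) \<in> min_cone u"
      using extend_beyond_face_point[OF uv l \<open>v \<in> V\<close>] by blast
    show ?thesis
      using face_ofD[OF face mem_open_segment_extension[OF \<epsilon>(1) False] \<epsilon>(2) _ \<open>v \<in> \<tau>\<close>]
        l min_cone_antimono[OF uv] by blast
  qed (use \<open>v \<in> \<tau>\<close> in simp)
  moreover have "l \<in> min_cone v" if l: "l \<in> \<tau>" for l
  proof -
    \<comment> \<open>As \<open>v\<close> is relatively interior, the segment from \<open>l\<close>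
      to \<open>v\<close> can be prolonged past \<open>v\<close> inside
      \<open>\<tau>\<close>.\<close>
    obtain r where r: "r > 1" "(1 - r) *\<^sub>R l + r *\<^sub>R v \<in> \<tau>"
      using v \<open>convex \<tau>\<close> \<open>\<tau> \<noteq> {}\<close> l convex_rel_interior_iff by (metis hull_inc)
    let ?n = "(1 - r) *\<^sub>R l + r *\<^sub>R v"
    have ul: "l \<in> V" "Min_at u \<subseteq> Min_at l" and un: "Min_at u \<subseteq> Min_at ?n"
      using l r face_of_imp_subset[OF face] by (auto simp: min_cone_def)
    have "a \<in> Min_at l" if a: "a \<in> Min_at v" for a
    proof -
      have "a \<in> F" using a by (simp add: minimizers_def)
      then obtain b where b: "b \<in> Min_at u" "\<kappa> b = \<kappa> a" using ex_minimizer[OF finite] by blast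
      have "\<phi> v a = \<phi> v b" using minimizers_eq_value[OF a, of b] b uv by auto
      moreover have "\<phi> ?n b \<le> \<phi> ?n a" using un b \<open>a \<in> F\<close> by (auto simp: minimizers_def)
      \<comment> \<open>The terms at \<open>v\<close> cancel because \<open>a\<close> and
        \<open>b\<close> tie there. The remaining factor \<open>1 - r\<close> is negative, so the
        comparison is reversed at \<open>l\<close>.\<close>
      ultimately have "(1 - r) * \<phi> l b \<le> (1 - r) * \<phi> l a" by (simp add: phi_add phi_scale)
      with r have "\<phi> l a \<le> \<phi> l b" by simp
      with ul b \<open>a \<in> F\<close> show ?thesis by (auto intro: minimizersI_le[of b])
    qed
    with ul show ?thesis by (auto simp: min_cone_def)
  qed
  ultimately show ?thesis using vu by blast
qed

end

section \<open>Closures of independent sets\<close>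

context matroid
begin

lemma indep_finite: "A \<in> F \<Longrightarrow> finite A" and indep_subset: "A \<in> F \<Longrightarrow> A \<subseteq> E"
  using indep_subset_ground finite_ground by (auto intro: finite_subset)

lemma finite_F: "finite F"
  using indep_subset_ground finite_ground by (meson finite_Pow_iff finite_subset)

lemma card_le_rank: "I \<in> F \<Longrightarrow> I \<subseteq> S \<Longrightarrow> card I \<le> matroid_rank F S"
  unfolding matroid_rank_def using finite_F by (intro Max_ge) auto

lemma ex_rank: "\<exists>I\<in>F. I \<subseteq> S \<and> card I = matroid_rank F S"
proof -
  have "matroid_rank F S \<in> card ` {I \<in> F. I \<subseteq> S}"
    unfolding matroid_rank_def using finite_F empty_indep by (intro Max_in) auto
  then show ?thesis by auto
qed

lemma rank_indep: "A \<in> F \<Longrightarrow> matroid_rank F A = card A"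
  using card_le_rank[of A A] ex_rank[of A] indep_finite[of A] by (auto intro!: antisym dest: card_mono)

text \<open>Reduces closures of independent sets to independence, so that the later arguments can
  use augmentation directly.\<close>

lemma mem_closure_indep_iff:
  assumes "A \<in> F"
  shows "e \<in> matroid_closure E F A \<longleftrightarrow> e \<in> E \<and> (e \<in> A \<or> insert e A \<notin> F)"
proof -
  have "matroid_rank F (insert e A) = card A \<longleftrightarrow> insert e A \<notin> F" if "e \<notin> A"
  proof
    assume "matroid_rank F (insert e A) = card A"
    then show "insert e A \<notin> F" using rank_indep[of "insert e A"] indep_finite[OF assms] that by auto
  next
    assume dep: "insert e A \<notin> F"
    obtain I where I: "I \<in> F" "I \<subseteq> insert e A" "card I = matroid_rank F (insert e A)"
      using ex_rank by blast
    \<comment> \<open>A larger \<open>I\<close> would augment \<open>A\<close> by an element of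
      \<open>insert e A\<close>, necessarily \<open>e\<close>, although \<open>insert e A\<close> is
      dependent.\<close>
    have "card I \<le> card A"
    proof (rule ccontr)
      assume "\<not> ?thesis"
      then obtain b where "b \<in> I - A" "insert b A \<in> F" using augmentation[OF assms I(1)] by auto
      with I dep show False by auto
    qed
    then show "matroid_rank F (insert e A) = card A"
      using I card_le_rank[OF assms subset_insertI[of A e]] by simp
  qed
  then show ?thesis
    unfolding matroid_closure_def using rank_indep[OF assms] by (cases "e \<in> A") (auto simp: insert_absorb)
qed

text \<open>Otherwise augmentation extends the smaller set by an element of the larger one. That
  element lies in the common closure, yet no element of the closure outside an independent set
  extends it independently.\<close>

lemma card_eq_of_closure_eq:
  assumes "A \<in> F" "B \<in> F" "matroid_closure E F A = matroid_closure E F B"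
  shows "card A = card B"
proof -
  have "card T \<le> card S" if ST: "S \<in> F" "T \<in> F" "matroid_closure E F S = matroid_closure E F T" for S T
  proof (rule ccontr)
    assume "\<not> ?thesis"
    then obtain b where b: "b \<in> T" "b \<notin> S" "insert b S \<in> F"
      using augmentation[OF ST(1,2)] by auto
    have "b \<in> matroid_closure E F T"
      using mem_closure_indep_iff[OF ST(2)] b indep_subset[OF ST(2)] by blast
    with b show False
      using mem_closure_indep_iff[OF ST(1)] ST(3) by simp
  qed
  from this[OF assms] this[OF assms(2,1) assms(3)[symmetric]] show ?thesis by simp
qed

text \<open>Since \<open>e\<close> extends \<open>A\<close>, it lies outside the common closure and
  therefore extends \<open>B\<close>. The two new closures are compared by augmentation, in both
  directions.\<close>

lemma closure_eq_insert:
  assumes "A \<in> F" "B \<in> F" "matroid_closure E F A = matroid_closure E F B"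
    and "e \<notin> A" "insert e A \<in> F"
  shows "e \<notin> B \<and> insert e B \<in> F \<and> matroid_closure E F (insert e A) = matroid_closure E F (insert e B)"
proof -
  have step: "e \<notin> T \<and> insert e T \<in> F"
    if "S \<in> F" "T \<in> F" "matroid_closure E F S = matroid_closure E F T" "e \<notin> S" "insert e S \<in> F" for S T e
    using mem_closure_indep_iff[OF that(1), of e] mem_closure_indep_iff[OF that(2), of e]
      that(3-5) indep_subset[OF that(5)] by simp
  have eB: "e \<notin> B" "insert e B \<in> F" using step[OF assms] by auto
  have "matroid_closure E F (insert e T) \<subseteq> matroid_closure E F (insert e S)"
    if S: "S \<in> F" and T: "T \<in> F" and eq: "matroid_closure E F S = matroid_closure E F T"
      and eS: "e \<notin> S" "insert e S \<in> F" and eT: "e \<notin> T" "insert e T \<in> F" for S T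
  proof (rule subsetI, rule ccontr)
    fix f assume f: "f \<in> matroid_closure E F (insert e T)" "f \<notin> matroid_closure E F (insert e S)"
    then have "f \<in> E" using mem_closure_indep_iff[OF eT(2)] by simp
    then have ind: "f \<notin> insert e S" "insert f (insert e S) \<in> F"
      using f(2) mem_closure_indep_iff[OF eS(2)] by auto
    \<comment> \<open>The sizes are \<open>card T + 1\<close> and \<open>card S + 2\<close>, where
      \<open>card S = card T\<close>. The augmenting element is either \<open>f\<close>, contrary to
      \<open>f\<close> being in the closure of \<open>insert e T\<close>, or an element of
      \<open>S\<close> that extends \<open>T\<close>, contrary to the equal closures of
      \<open>S\<close> and \<open>T\<close>.\<close>
    have "card (insert e T) < card (insert f (insert e S))"
      using card_eq_of_closure_eq[OF S T eq] indep_finite S T eS eT ind by simp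
    then obtain b where b: "b \<in> insert f (insert e S) - insert e T" "insert b (insert e T) \<in> F"
      using augmentation[OF eT(2) ind(2)] by blast
    show False
    proof (cases "b = f")
      case True
      then show ?thesis using b f(1) mem_closure_indep_iff[OF eT(2), of f] by auto
    next
      case False
      then have "b \<in> S" "b \<notin> T" using b by auto
      moreover have "insert b T \<in> F" using b(2) by (rule hereditary) auto
      ultimately show ?thesis using step[OF T S eq[symmetric], of b] by simp
    qed
  qed
  from this[OF assms(1,2,3,4,5) eB] this[OF assms(2,1) assms(3)[symmetric] eB assms(4,5)]
  show ?thesis using eB by blast
qed

text \<open>The combinatorial form of the stability of closure classes under multiplication by
  \<open>XS S\<close>; the elements of \<open>S\<close> are adjoined one at a time.\<close>

lemma closure_eq_Un:
  assumes "A \<in> F" "B \<in> F" "matroid_closure E F A = matroid_closure E F B"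
    and "S \<inter> A = {}" "S \<union> A \<in> F"
  shows "S \<inter> B = {} \<and> S \<union> B \<in> F \<and> matroid_closure E F (S \<union> A) = matroid_closure E F (S \<union> B)"
proof -
  have "finite S" using indep_finite[OF assms(5)] by simp
  then show ?thesis using assms(4,5)
  proof (induction S)
    case empty
    with assms show ?case by simp
  next
    case (insert s S)
    then have "S \<union> A \<in> F" using hereditary[of "insert s S \<union> A" "S \<union> A"] by blast
    with insert have IH: "S \<inter> B = {}" "S \<union> B \<in> F" "matroid_closure E F (S \<union> A) = matroid_closure E F (S \<union> B)"
      by auto
    show ?case
      using closure_eq_insert[OF \<open>S \<union> A \<in> F\<close> IH(2,3), of s] insert IH by auto
  qed
qed

text \<open>The bases thus form a single closure class, so minimality within the class of a basis
  compares it with all bases.\<close>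

lemma closure_basis_iff:
  assumes "A \<in> F"
  shows "A \<in> bases F \<longleftrightarrow> matroid_closure E F A = E"
proof
  assume A: "A \<in> bases F"
  have "e \<in> A" if "insert e A \<in> F" for e
    using A that by (auto simp: bases_def)
  then show "matroid_closure E F A = E"
    using mem_closure_indep_iff[OF assms] by blast
next
  assume cl: "matroid_closure E F A = E"
  have "B \<subseteq> A" if "B \<in> F" "A \<subseteq> B" for B
  proof
    fix e assume "e \<in> B"
    then have "e \<in> matroid_closure E F A" using cl indep_subset[OF \<open>B \<in> F\<close>] by auto
    moreover have "insert e A \<in> F" using that \<open>e \<in> B\<close> by (auto intro: hereditary)
    ultimately show "e \<in> A" using mem_closure_indep_iff[OF assms] by auto
  qed
  with assms show "A \<in> bases F" by (auto simp: bases_def)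
qed

lemma bases_nonempty: "bases F \<noteq> {}"
proof -
  obtain B where "B \<in> F" "\<forall>B'\<in>F. B \<subseteq> B' \<longrightarrow> B = B'"
    using finite_has_maximal[OF finite_F] empty_indep by blast
  then show ?thesis by (auto simp: bases_def)
qed

end

section \<open>Monomials and ideals of the polynomial ring\<close>

definition squarefree :: "'e::finite set \<Rightarrow> ('e \<Rightarrow>\<^sub>0 nat)" where
  "squarefree A = (\<Sum>e\<in>A. Poly_Mapping.single e 1)"

lemma lookup_squarefree: "Poly_Mapping.lookup (squarefree A) e = (if e \<in> A then 1 else 0)"
  by (simp add: squarefree_def lookup_sum lookup_single when_def)

lemma keys_squarefree [simp]: "Poly_Mapping.keys (squarefree A) = A"
  by (auto simp: in_keys_iff lookup_squarefree split: if_splits)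

lemma squarefree_inject [simp]: "squarefree A = squarefree B \<longleftrightarrow> A = B"
  by (metis keys_squarefree)

lemma XS_squarefree: "XS A = Poly_Mapping.single (squarefree A) 1"
  by (simp add: XS_eq_single squarefree_def)

lemma squarefree_union:
  "S \<inter> T = {} \<Longrightarrow> squarefree (S \<union> T) = squarefree S + squarefree T"
  by (simp add: squarefree_def sum.union_disjoint)

text \<open>The exponents of the sum are at most 1, so at each variable at most one of the two
  summands is nonzero.\<close>

lemma add_eq_squarefreeE:
  assumes "m + n = squarefree A"
  obtains S T where "m = squarefree S" "n = squarefree T" "S \<inter> T = {}" "S \<union> T = A"
proof
  have l: "Poly_Mapping.lookup m e + Poly_Mapping.lookup n e = (if e \<in> A then 1 else 0)" for e
    using assms by (metis lookup_add lookup_squarefree)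
  show "m = squarefree (Poly_Mapping.keys m)"
  proof (rule poly_mapping_eqI)
    show "Poly_Mapping.lookup m e = Poly_Mapping.lookup (squarefree (Poly_Mapping.keys m)) e" for e
      using l[of e] by (auto simp: lookup_squarefree in_keys_iff split: if_splits)
  qed
  show "n = squarefree (Poly_Mapping.keys n)"
  proof (rule poly_mapping_eqI)
    show "Poly_Mapping.lookup n e = Poly_Mapping.lookup (squarefree (Poly_Mapping.keys n)) e" for e
      using l[of e] by (auto simp: lookup_squarefree in_keys_iff split: if_splits)
  qed
  show "Poly_Mapping.keys m \<inter> Poly_Mapping.keys n = {}"
  proof (rule equals0I)
    fix e assume "e \<in> Poly_Mapping.keys m \<inter> Poly_Mapping.keys n"
    then show False using l[of e] by (auto simp: in_keys_iff split: if_splits)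
  qed
  show "Poly_Mapping.keys m \<union> Poly_Mapping.keys n = A"
  proof (rule Set.set_eqI)
    show "e \<in> Poly_Mapping.keys m \<union> Poly_Mapping.keys n \<longleftrightarrow> e \<in> A" for e
      using l[of e] by (auto simp: in_keys_iff split: if_splits)
  qed
qed

text \<open>Some exponent is at least 2. This later brings such monomials under the generators
  \<open>(X e)\<^sup>2\<close>.\<close>

lemma not_squarefreeE:
  assumes "\<nexists>A. m = squarefree A"
  obtains e n where "m = n + Poly_Mapping.single e 2"
proof -
  have "\<exists>e. Poly_Mapping.lookup m e \<ge> 2"
  proof (rule ccontr)
    assume "\<not> ?thesis"
    then have "Poly_Mapping.lookup m e = 0 \<or> Poly_Mapping.lookup m e = 1" for e
      by (metis One_nat_def less_2_cases not_le)
    then have "Poly_Mapping.lookup m e = Poly_Mapping.lookup (squarefree (Poly_Mapping.keys m)) e" for e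
      using in_keys_iff[of e m] by (fastforce simp: lookup_squarefree)
    then have "m = squarefree (Poly_Mapping.keys m)" by (rule poly_mapping_eqI)
    with assms show False by blast
  qed
  then obtain e where "Poly_Mapping.lookup m e \<ge> 2" by blast
  then have "m = (m - Poly_Mapping.single e 2) + Poly_Mapping.single e 2"
    by (intro poly_mapping_eqI) (auto simp: lookup_add lookup_minus lookup_single when_def)
  then show ?thesis using that by blast
qed

definition set_weight :: "real ^ 'e \<Rightarrow> 'e::finite set \<Rightarrow> real" where
  "set_weight w A = (\<Sum>e\<in>A. w $ e)"

lemma weight_squarefree: "weight w (squarefree A) = set_weight w A"
  by (simp add: weight_def set_weight_def lookup_squarefree)

lemma linear_set_weight: "linear (\<lambda>w. set_weight w A)"
  by (rule linearI) (simp_all add: set_weight_def sum.distrib sum_distrib_left)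

lemma set_weight_union: "S \<inter> T = {} \<Longrightarrow> set_weight w (S \<union> T) = set_weight w S + set_weight w T"
  by (simp add: set_weight_def sum.union_disjoint)

section \<open>Ideals of the polynomial ring\<close>

lemma mpoly_ring_simps [simp]:
  "carrier (mpoly_ring E) = {p. \<forall>m\<in>Poly_Mapping.keys p. Poly_Mapping.keys m \<subseteq> E}"
  "mult (mpoly_ring E) = (*)" "one (mpoly_ring E) = 1"
  "zero (mpoly_ring E) = 0" "add (mpoly_ring E) = (+)"
  by (simp_all add: mpoly_ring_def)

lemma single_in_carrier:
  "Poly_Mapping.keys m \<subseteq> E \<Longrightarrow> (Poly_Mapping.single m a :: ('e, 'k::comm_ring_1) mpoly) \<in> carrier (mpoly_ring E)"
  by simp

lemma X_square: "(X e :: ('e, 'k::comm_ring_1) mpoly)\<^sup>2 = Poly_Mapping.single (Poly_Mapping.single e 2) 1"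
  by (simp add: X_def power2_eq_square mult_single single_add[symmetric] numeral_2_eq_2)

lemma single_one_nonzero: "Poly_Mapping.single m (1::'k::comm_ring_1) \<noteq> 0"
  by (metis lookup_single_eq lookup_zero one_neq_zero)

lemma diff_in_carrier:
  assumes "p \<in> carrier (mpoly_ring E)" "q \<in> carrier (mpoly_ring E)"
  shows "(p - q :: ('e, 'k::comm_ring_1) mpoly) \<in> carrier (mpoly_ring E)"
  using assms keys_diff[of p q] by auto

lemma ideal_mpoly_ringI:
  fixes I :: "('e, 'k::comm_ring_1) mpoly set"
  assumes "I \<subseteq> carrier (mpoly_ring E)" "0 \<in> I" "\<And>p q. p \<in> I \<Longrightarrow> q \<in> I \<Longrightarrow> p + q \<in> I"
    and mult: "\<And>p q. p \<in> carrier (mpoly_ring E) \<Longrightarrow> q \<in> I \<Longrightarrow> p * q \<in> I"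
  shows "ideal I (mpoly_ring E)"
proof -
  interpret cring "mpoly_ring E :: ('e, 'k) mpoly ring" by (rule cring_mpoly_ring)
  have inv: "inv\<^bsub>add_monoid (mpoly_ring E)\<^esub> p = - p" if "p \<in> I" for p
  proof -
    have "\<ominus>\<^bsub>mpoly_ring E\<^esub> p = - p"
      using that assms(1) by (intro minus_equality) auto
    then show ?thesis by (simp add: a_inv_def)
  qed
  have neg: "- p \<in> I" if "p \<in> I" for p
    using mult[of "-1" p] that by simp
  show ?thesis
  proof (intro idealI subgroup.intro ring_axioms)
    show "inv\<^bsub>add_monoid (mpoly_ring E)\<^esub> p \<in> I" if "p \<in> I" for p
      unfolding inv[OF that] using that by (rule neg)
    show "q \<otimes>\<^bsub>mpoly_ring E\<^esub> p \<in> I" if "p \<in> I" "q \<in> carrier (mpoly_ring E)" for p q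
      using mult[of q p] that by simp
    show "p \<otimes>\<^bsub>mpoly_ring E\<^esub> q \<in> I" if "p \<in> I" "q \<in> carrier (mpoly_ring E)" for p q
      using mult[of q p] that by (simp add: mult.commute)
  qed (use assms in auto)
qed

lemma ideal_mpoly_ringD:
  fixes I :: "('e, 'k::comm_ring_1) mpoly set"
  assumes "ideal I (mpoly_ring E)"
  shows "I \<subseteq> carrier (mpoly_ring E)" "0 \<in> I" "p \<in> I \<Longrightarrow> q \<in> I \<Longrightarrow> p + q \<in> I"
    "p \<in> carrier (mpoly_ring E) \<Longrightarrow> q \<in> I \<Longrightarrow> p * q \<in> I"
proof -
  interpret ideal I "mpoly_ring E" by fact
  show "I \<subseteq> carrier (mpoly_ring E)" by (rule a_subset)
  show "0 \<in> I" using additive_subgroup.zero_closed[OF is_additive_subgroup] by simp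
  show "p + q \<in> I" if "p \<in> I" "q \<in> I" using additive_subgroup.a_closed[OF is_additive_subgroup that] by simp
  show "p * q \<in> I" if "p \<in> carrier (mpoly_ring E)" "q \<in> I"
    using I_l_closed[OF that(2,1)] by simp
qed

lemma ideal_mpoly_ring_sum:
  fixes I :: "('e, 'k::comm_ring_1) mpoly set"
  assumes "ideal I (mpoly_ring E)" "\<And>a. a \<in> A \<Longrightarrow> f a \<in> I"
  shows "sum f A \<in> I"
  using assms(2)
  by (induction A rule: infinite_finite_induct) (auto intro: ideal_mpoly_ringD[OF assms(1)])

lemma ideal_genideal_mpoly_ring:
  fixes S :: "('e, 'k::comm_ring_1) mpoly set"
  assumes "S \<subseteq> carrier (mpoly_ring E)"
  shows "ideal (genideal (mpoly_ring E) S) (mpoly_ring E)"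
proof -
  interpret cring "mpoly_ring E :: ('e, 'k) mpoly ring" by (rule cring_mpoly_ring)
  show ?thesis using assms by (rule genideal_ideal)
qed

lemma genideal_subset_ideal: "ideal I R \<Longrightarrow> S \<subseteq> I \<Longrightarrow> genideal R S \<subseteq> I"
  by (auto simp: genideal_def)

lemma subset_genideal: "S \<subseteq> genideal R S"
  by (auto simp: genideal_def)

section \<open>Linear functionals on polynomials and their annihilators\<close>

definition pairing :: "('m \<Rightarrow> 'k) \<Rightarrow> ('m \<Rightarrow>\<^sub>0 'k::comm_ring_1) \<Rightarrow> 'k" where
  "pairing c p = (\<Sum>m\<in>Poly_Mapping.keys p. Poly_Mapping.lookup p m * c m)"

lemma pairing_add: "pairing c (p + q) = pairing c p + pairing c q"
  unfolding pairing_def by (rule setsum_keys_plus_distrib) (simp_all add: algebra_simps)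

lemma pairing_zero [simp]: "pairing c 0 = 0"
  by (simp add: pairing_def)

lemma pairing_sum: "pairing c (sum f A) = (\<Sum>a\<in>A. pairing c (f a))"
  by (induction A rule: infinite_finite_induct) (simp_all add: pairing_add)

lemma pairing_single [simp]: "pairing c (Poly_Mapping.single m a) = a * c m"
  by (cases "a = 0") (simp_all add: pairing_def)

lemma pairing_diff: "pairing c (p - q) = pairing c p - pairing c q"
  using pairing_add[of c "p - q" q] by simp

lemma poly_mapping_sum_singles:
  "(p :: 'm \<Rightarrow>\<^sub>0 'k::comm_monoid_add) = (\<Sum>m\<in>Poly_Mapping.keys p. Poly_Mapping.single m (Poly_Mapping.lookup p m))"
  by (rule poly_mapping_eqI) (auto simp: lookup_sum lookup_single when_def in_keys_iff)

lemma pairing_mult: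
  fixes p q :: "'m::cancel_comm_monoid_add \<Rightarrow>\<^sub>0 'k::comm_ring_1"
  shows "pairing c (p * q)
    = (\<Sum>m\<in>Poly_Mapping.keys p. Poly_Mapping.lookup p m * pairing (\<lambda>n. c (m + n)) q)"
proof -
  have "p * q = (\<Sum>m\<in>Poly_Mapping.keys p. Poly_Mapping.single m (Poly_Mapping.lookup p m))
      * (\<Sum>n\<in>Poly_Mapping.keys q. Poly_Mapping.single n (Poly_Mapping.lookup q n))"
    by (rule arg_cong2[OF poly_mapping_sum_singles poly_mapping_sum_singles])
  then have "pairing c (p * q) = (\<Sum>m\<in>Poly_Mapping.keys p. \<Sum>n\<in>Poly_Mapping.keys q.
      Poly_Mapping.lookup p m * Poly_Mapping.lookup q n * c (m + n))"
    by (simp add: sum_product mult_single pairing_sum)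
  then show ?thesis
    by (simp add: pairing_def[of _ q] sum_distrib_left mult.assoc)
qed

text \<open>Pairing \<open>c\<close> with \<open>p * q\<close> is a linear combination of the
  pairings of \<open>q\<close> with shifts of \<open>c\<close>, so a family closed under shifts has
  an annihilator that absorbs multiplication.\<close>

lemma ideal_annihilator:
  fixes \<Gamma> :: "(('e \<Rightarrow>\<^sub>0 nat) \<Rightarrow> 'k::comm_ring_1) set"
  assumes shift: "\<And>c m. c \<in> \<Gamma> \<Longrightarrow> (\<lambda>n. c (m + n)) \<in> \<Gamma>"
  shows "ideal {g \<in> carrier (mpoly_ring E). \<forall>c\<in>\<Gamma>. pairing c g = 0} (mpoly_ring E)"
proof -
  interpret cring "mpoly_ring E :: ('e, 'k) mpoly ring" by (rule cring_mpoly_ring)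
  let ?I = "{g \<in> carrier (mpoly_ring E). \<forall>c\<in>\<Gamma>. pairing c g = 0}"
  show ?thesis
  proof (rule ideal_mpoly_ringI)
    show "0 \<in> ?I" by simp
    show "p + q \<in> ?I" if "p \<in> ?I" "q \<in> ?I" for p q
      using that a_closed[of p q] by (simp add: pairing_add)
    show "p * q \<in> ?I" if p: "p \<in> carrier (mpoly_ring E)" and q: "q \<in> ?I" for p q
    proof -
      have "pairing c (p * q) = 0" if "c \<in> \<Gamma>" for c
        unfolding pairing_mult using q shift[OF that] by (intro sum.neutral) simp
      with m_closed[OF p, of q] q show ?thesis by simp
    qed
  qed blast
qed

section \<open>Initial forms of monomials and binomials\<close>

lemma lookup_initial_form:
  "Poly_Mapping.lookup (initial_form w f) m =
     (if \<forall>m'\<in>Poly_Mapping.keys f. weight w m' \<le> weight w m then Poly_Mapping.lookup f m else 0)"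
  by (auto simp: initial_form_def lookup_sum lookup_single when_def in_keys_iff)

lemma keys_initial_form: "Poly_Mapping.keys (initial_form w f) \<subseteq> Poly_Mapping.keys f"
  by (auto simp: in_keys_iff lookup_initial_form split: if_splits)

lemma initial_form_single [simp]:
  "initial_form w (Poly_Mapping.single m a) = Poly_Mapping.single m a"
  by (rule poly_mapping_eqI) (auto simp: lookup_initial_form lookup_single when_def split: if_splits)

lemma keys_binomial:
  assumes "m \<noteq> n"
  shows "Poly_Mapping.keys (Poly_Mapping.single m 1 - Poly_Mapping.single n (1::'k::comm_ring_1)) = {m, n}"
  using assms by (auto simp: in_keys_iff lookup_minus lookup_single when_def split: if_splits)

lemma initial_form_binomial_less:
  assumes "weight w n < weight w m"
  shows "initial_form w (Poly_Mapping.single m 1 - Poly_Mapping.single n (1::'k::comm_ring_1)) = Poly_Mapping.single m 1"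
proof -
  from assms have "m \<noteq> n" by auto
  with assms show ?thesis
    by (intro poly_mapping_eqI)
       (auto simp: lookup_initial_form keys_binomial lookup_minus lookup_single when_def)
qed

lemma initial_form_binomial_eq:
  assumes "weight w n = weight w m"
  shows "initial_form w (Poly_Mapping.single m 1 - Poly_Mapping.single n (1::'k::comm_ring_1))
    = Poly_Mapping.single m 1 - Poly_Mapping.single n 1"
proof (cases "m = n")
  case False
  with assms show ?thesis
    by (intro poly_mapping_eqI)
       (auto simp: lookup_initial_form keys_binomial lookup_minus lookup_single when_def)
qed (simp add: initial_form_def)

section \<open>The initial ideals\<close>

locale finite_type_matroid = matroid E F for E :: "'e::finite set" and F
begin

abbreviation cl :: "'e set \<Rightarrow> 'e set" where "cl \<equiv> matroid_closure E F"

abbreviation min_indep :: "real ^ 'e \<Rightarrow> 'e set set" where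
  "min_indep w \<equiv> minimizers F cl (set_weight w)"

text \<open>Coefficient functionals that cut out the initial ideal. Describing the ideal by functionals
  turns multiplication by a monomial into a mere shift of the argument.\<close>

definition class_functionals :: "'e set set \<Rightarrow> (('e \<Rightarrow>\<^sub>0 nat) \<Rightarrow> 'k::comm_ring_1) set" where
  "class_functionals N = {c. (\<forall>m. c m \<noteq> 0 \<longrightarrow> m \<in> squarefree ` N) \<and>
     (\<forall>A\<in>N. \<forall>B\<in>N. cl A = cl B \<longrightarrow> c (squarefree A) = c (squarefree B))}"

definition class_ideal :: "'e set set \<Rightarrow> ('e, 'k::comm_ring_1) mpoly set" where
  "class_ideal N = {g \<in> carrier (mpoly_ring E). \<forall>c\<in>class_functionals N. pairing c g = 0}"

lemma class_functionals_nonzero: "c \<in> class_functionals N \<Longrightarrow> c m \<noteq> 0 \<Longrightarrow> m \<in> squarefree ` N"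
  by (simp add: class_functionals_def)

lemma class_functionals_eq:
  "c \<in> class_functionals N \<Longrightarrow> A \<in> N \<Longrightarrow> B \<in> N \<Longrightarrow> cl A = cl B \<Longrightarrow> c (squarefree A) = c (squarefree B)"
  unfolding class_functionals_def by blast

lemma min_indep_F: "A \<in> min_indep w \<Longrightarrow> A \<in> F"
  by (simp add: minimizers_def)

text \<open>At weight 0 all sets tie. Results about \<open>min_indep w\<close> therefore specialize
  to \<open>F\<close>, the family that belongs to the ideal \<open>J_ideal E F\<close>
  itself.\<close>

lemma min_indep_zero [simp]: "min_indep 0 = F"
  by (auto simp: minimizers_def set_weight_def)

text \<open>A lighter set \<open>B\<close> with the closure of \<open>T\<close> would give
  \<open>S \<union> B\<close>, lighter than \<open>S \<union> T\<close> and of the same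
  closure.\<close>

lemma min_indep_Un:
  assumes "S \<union> T \<in> min_indep w" "S \<inter> T = {}"
  shows "T \<in> min_indep w"
proof -
  have ST: "S \<union> T \<in> F" "T \<in> F" using min_indep_F[OF assms(1)] hereditary[of "S \<union> T" T] by auto
  have "set_weight w T \<le> set_weight w B" if "B \<in> F" "cl B = cl T" for B
  proof -
    have "S \<inter> B = {}" "S \<union> B \<in> F" "cl (S \<union> T) = cl (S \<union> B)"
      using closure_eq_Un[of T B S] ST that assms(2) by auto
    then have "set_weight w (S \<union> T) \<le> set_weight w (S \<union> B)"
      using assms(1) by (auto simp: minimizers_def)
    then show ?thesis using assms(2) \<open>S \<inter> B = {}\<close> by (simp add: set_weight_union)
  qed
  with ST show ?thesis by (auto simp: minimizers_def)
qed

text \<open>\<open>A\<close> is minimal as a part of \<open>S \<union> A\<close>, so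
  \<open>A\<close> and \<open>B\<close> have equal weight; hence \<open>S \<union> B\<close> ties
  with the minimal set \<open>S \<union> A\<close>.\<close>

lemma min_indep_Un_exchange:
  assumes "S \<union> A \<in> min_indep w" "S \<inter> A = {}" "B \<in> min_indep w" "cl A = cl B"
  shows "S \<union> B \<in> min_indep w \<and> S \<inter> B = {} \<and> cl (S \<union> A) = cl (S \<union> B)"
proof -
  have A: "A \<in> min_indep w" using assms(1,2) by (rule min_indep_Un)
  have SB: "S \<inter> B = {}" "S \<union> B \<in> F" "cl (S \<union> A) = cl (S \<union> B)"
    using closure_eq_Un[OF min_indep_F[OF A] min_indep_F[OF assms(3)] assms(4,2) min_indep_F[OF assms(1)]]
    by auto
  have "set_weight w A = set_weight w B"
    using A assms(3,4) by (rule minimizers_eq_value)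
  then have "S \<union> B \<in> min_indep w"
    using SB assms(2) by (intro minimizersI_le[OF assms(1)]) (auto simp: set_weight_union)
  with SB show ?thesis by simp
qed

text \<open>This is what makes \<open>class_ideal (min_indep w)\<close> an ideal. The support
  condition follows from minimality of parts of minimal sets, the constancy on classes from the
  exchange of \<open>A\<close> for \<open>B\<close>.\<close>

lemma class_functionals_shift:
  assumes "c \<in> class_functionals (min_indep w)"
  shows "(\<lambda>n. c (m + n)) \<in> class_functionals (min_indep w)"
proof -
  have "n \<in> squarefree ` min_indep w" if nz: "c (m + n) \<noteq> 0" for n
  proof -
    obtain A where A: "m + n = squarefree A" "A \<in> min_indep w"
      using class_functionals_nonzero[OF assms nz] by auto
    then obtain S T where "n = squarefree T" "S \<inter> T = {}" "S \<union> T = A"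
      by (elim add_eq_squarefreeE)
    with A show ?thesis using min_indep_Un[of S T w] by auto
  qed
  moreover have "c (m + squarefree A) = c (m + squarefree B)"
    if "A \<in> min_indep w" "B \<in> min_indep w" "cl A = cl B" for A B
  proof -
    \<comment> \<open>Only a nonzero value reveals that \<open>m\<close> is squarefree and disjoint
      from \<open>P\<close>, so one value is assumed nonzero; the claim is then applied from either
      side.\<close>
    have *: "c (m + squarefree P) = c (m + squarefree Q)"
      if PQ: "P \<in> min_indep w" "Q \<in> min_indep w" "cl P = cl Q" and nz: "c (m + squarefree P) \<noteq> 0" for P Q
    proof -
      obtain C where C: "m + squarefree P = squarefree C" "C \<in> min_indep w"
        using class_functionals_nonzero[OF assms nz] by auto
      obtain S T where S: "m = squarefree S" "squarefree P = squarefree T" "S \<inter> T = {}" "S \<union> T = C"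
        using C(1) by (elim add_eq_squarefreeE)
      then have SP: "S \<union> P \<in> min_indep w" "S \<inter> P = {}" using C by auto
      note ex = min_indep_Un_exchange[OF SP PQ(2,3)]
      show ?thesis
        using class_functionals_eq[OF assms SP(1), of "S \<union> Q"] ex SP
        by (simp add: S(1) squarefree_union)
    qed
    show ?thesis
    proof (cases "c (m + squarefree A) = 0 \<and> c (m + squarefree B) = 0")
      case False
      then show ?thesis using *[OF that] *[OF that(2,1) that(3)[symmetric]] by fastforce
    qed simp
  qed
  ultimately show ?thesis unfolding class_functionals_def by blast
qed

lemma ideal_class_ideal: "ideal (class_ideal (min_indep w)) (mpoly_ring E)"
  unfolding class_ideal_def by (rule ideal_annihilator) (rule class_functionals_shift)

section \<open>The ideal \<open>J_ideal E F\<close> and its generators\<close>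

lemma ideal_J_ideal: "ideal (J_ideal E F :: ('e, 'k::comm_ring_1) mpoly set) (mpoly_ring E)"
  unfolding J_ideal_def
proof (rule ideal_genideal_mpoly_ring, intro Un_least subsetI)
  fix p :: "('e, 'k) mpoly" assume "p \<in> {(X e)\<^sup>2 | e. e \<in> E}"
  then show "p \<in> carrier (mpoly_ring E)" by (auto simp: X_square split: if_splits)
next
  fix p :: "('e, 'k) mpoly" assume "p \<in> {XS S | S. S \<subseteq> E \<and> S \<notin> F}"
  then show "p \<in> carrier (mpoly_ring E)" by (auto simp: XS_squarefree)
next
  fix p :: "('e, 'k) mpoly"
  assume "p \<in> {XS A - XS A' | A A'. A \<in> F \<and> A' \<in> F \<and> cl A = cl A'}"
  then obtain A A' where A: "p = XS A - XS A'" "A \<in> F" "A' \<in> F" by blast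
  show "p \<in> carrier (mpoly_ring E)"
    unfolding A(1) XS_squarefree
    using indep_subset[OF A(2)] indep_subset[OF A(3)]
    by (intro diff_in_carrier single_in_carrier) simp_all
qed

lemma X_square_in_J: "e \<in> E \<Longrightarrow> (X e)\<^sup>2 \<in> (J_ideal E F :: ('e, 'k::comm_ring_1) mpoly set)"
  unfolding J_ideal_def by (rule subsetD[OF subset_genideal]) blast

lemma XS_dependent_in_J: "S \<subseteq> E \<Longrightarrow> S \<notin> F \<Longrightarrow> XS S \<in> (J_ideal E F :: ('e, 'k::comm_ring_1) mpoly set)"
  unfolding J_ideal_def by (rule subsetD[OF subset_genideal]) blast

lemma XS_diff_in_J:
  "A \<in> F \<Longrightarrow> B \<in> F \<Longrightarrow> cl A = cl B \<Longrightarrow> XS A - XS B \<in> (J_ideal E F :: ('e, 'k::comm_ring_1) mpoly set)"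
  unfolding J_ideal_def by (rule subsetD[OF subset_genideal]) blast

text \<open>\<open>class_ideal F\<close> is an ideal, by the case of weight 0, so it is enough that
  the functionals vanish on the three kinds of generators.\<close>

lemma J_ideal_subset_class_ideal: "J_ideal E F \<subseteq> (class_ideal F :: ('e, 'k::comm_ring_1) mpoly set)"
proof -
  have carrier: "J_ideal E F \<subseteq> carrier (mpoly_ring E :: ('e, 'k) mpoly ring)"
    by (rule ideal_mpoly_ringD(1)[OF ideal_J_ideal])
  have memI: "p \<in> class_ideal F"
    if "p \<in> J_ideal E F" "\<And>c. c \<in> class_functionals F \<Longrightarrow> pairing c p = 0" for p :: "('e, 'k) mpoly"
    using that carrier unfolding class_ideal_def by blast
  have "p \<in> class_ideal F" if "p \<in> {(X e)\<^sup>2 | e. e \<in> E}" for p :: "('e, 'k) mpoly"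
  proof -
    obtain e where e: "p = (X e)\<^sup>2" "e \<in> E" using \<open>p \<in> _\<close> by blast
    have "Poly_Mapping.single e 2 \<noteq> squarefree A" for A
    proof
      assume "Poly_Mapping.single e 2 = squarefree A"
      then have "Poly_Mapping.lookup (Poly_Mapping.single e 2) e = Poly_Mapping.lookup (squarefree A) e" by simp
      then show False by (simp add: lookup_squarefree split: if_splits)
    qed
    then have "c (Poly_Mapping.single e 2) = 0" if "c \<in> class_functionals F" for c :: "('e \<Rightarrow>\<^sub>0 nat) \<Rightarrow> 'k"
      using class_functionals_nonzero[OF that] by blast
    then show ?thesis using X_square_in_J[OF e(2)] by (intro memI) (simp_all add: e(1) X_square)
  qed
  moreover have "p \<in> class_ideal F" if "p \<in> {XS S | S. S \<subseteq> E \<and> S \<notin> F}" for p :: "('e, 'k) mpoly"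
  proof -
    obtain S where S: "p = XS S" "S \<subseteq> E" "S \<notin> F" using \<open>p \<in> _\<close> by blast
    have "c (squarefree S) = 0" if "c \<in> class_functionals F" for c :: "('e \<Rightarrow>\<^sub>0 nat) \<Rightarrow> 'k"
      using class_functionals_nonzero[OF that] S(3) by fastforce
    then show ?thesis using XS_dependent_in_J[OF S(2,3)] by (intro memI) (simp_all add: S(1) XS_squarefree)
  qed
  moreover have "p \<in> class_ideal F"
    if "p \<in> {XS A - XS A' | A A'. A \<in> F \<and> A' \<in> F \<and> cl A = cl A'}" for p :: "('e, 'k) mpoly"
  proof -
    obtain A A' where A: "p = XS A - XS A'" "A \<in> F" "A' \<in> F" "cl A = cl A'" using \<open>p \<in> _\<close> by blast
    show ?thesis
      using XS_diff_in_J[OF A(2-4)] class_functionals_eq[OF _ A(2-4)]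
      by (intro memI) (simp_all add: A(1) XS_squarefree pairing_diff)
  qed
  ultimately show ?thesis
    using ideal_class_ideal[of 0] unfolding J_ideal_def min_indep_zero
    by (intro genideal_subset_ideal Un_least subsetI)
qed

text \<open>The choice depends on \<open>A\<close> only through its closure, so all members of a
  class share one representative.\<close>

definition min_rep :: "real ^ 'e \<Rightarrow> 'e set \<Rightarrow> 'e set" where
  "min_rep w A = (SOME B. B \<in> min_indep w \<and> cl B = cl A)"

lemma min_rep:
  assumes "A \<in> F"
  shows "min_rep w A \<in> min_indep w" "cl (min_rep w A) = cl A"
proof -
  have "\<exists>B. B \<in> min_indep w \<and> cl B = cl A" using ex_minimizer[OF finite_F assms] by blast
  from someI_ex[OF this] show "min_rep w A \<in> min_indep w" "cl (min_rep w A) = cl A"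
    by (simp_all add: min_rep_def)
qed

lemma min_rep_cong: "cl A = cl B \<Longrightarrow> min_rep w A = min_rep w B"
  by (simp add: min_rep_def)

text \<open>A functional \<open>c\<close> on the initial form is turned into a functional
  \<open>d\<close> in \<open>class_functionals F\<close> with the same value on \<open>f\<close>;
  and \<open>d\<close> annihilates \<open>f\<close>.\<close>

lemma initial_form_in_class_ideal:
  fixes f :: "('e, 'k::comm_ring_1) mpoly"
  assumes f: "f \<in> class_ideal F" and "f \<noteq> 0"
  shows "initial_form w f \<in> class_ideal (min_indep w)"
  unfolding class_ideal_def
proof (intro CollectI conjI ballI)
  show "initial_form w f \<in> carrier (mpoly_ring E)"
    using f keys_initial_form[of w f] by (auto simp: class_ideal_def)
  fix c :: "('e \<Rightarrow>\<^sub>0 nat) \<Rightarrow> 'k" assume c: "c \<in> class_functionals (min_indep w)"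
  define W where "W = Max (weight w ` Poly_Mapping.keys f)"
  have W: "weight w m \<le> W" if "m \<in> Poly_Mapping.keys f" for m
    using that by (simp add: W_def)
  have "W \<in> weight w ` Poly_Mapping.keys f"
    unfolding W_def using \<open>f \<noteq> 0\<close> by (intro Max_in) auto
  then obtain m\<^sub>0 where m\<^sub>0: "m\<^sub>0 \<in> Poly_Mapping.keys f" "weight w m\<^sub>0 = W" by blast
  have lookup: "Poly_Mapping.lookup (initial_form w f) m = (if weight w m = W then Poly_Mapping.lookup f m else 0)"
    if "m \<in> Poly_Mapping.keys f" for m
  proof -
    have "(\<forall>m'\<in>Poly_Mapping.keys f. weight w m' \<le> weight w m) \<longleftrightarrow> weight w m = W"
    proof
      assume "\<forall>m'\<in>Poly_Mapping.keys f. weight w m' \<le> weight w m"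
      then have "W \<le> weight w m" using m\<^sub>0 by blast
      with W[OF that] show "weight w m = W" by simp
    qed (use W in simp)
    then show ?thesis by (simp add: lookup_initial_form)
  qed
  \<comment> \<open>On a class whose minimal weight is the top weight \<open>W\<close> of
    \<open>f\<close>, \<open>d\<close> takes the value of \<open>c\<close> at the representative;
    elsewhere it is 0.\<close>
  define d where "d m = (if m \<in> squarefree ` F \<and> set_weight w (min_rep w (Poly_Mapping.keys m)) = W
      then c (squarefree (min_rep w (Poly_Mapping.keys m))) else 0)" for m
  have "d \<in> class_functionals F"
    unfolding class_functionals_def
  proof (intro CollectI conjI allI impI ballI)
    show "m \<in> squarefree ` F" if "d m \<noteq> 0" for m
      using that by (auto simp: d_def split: if_splits)
    show "d (squarefree A) = d (squarefree B)" if "A \<in> F" "B \<in> F" "cl A = cl B" for A B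
      using that min_rep_cong[OF that(3)] by (simp add: d_def)
  qed
  then have "pairing d f = 0" using f by (simp add: class_ideal_def)
  have "pairing c (initial_form w f) = (\<Sum>m\<in>Poly_Mapping.keys f. Poly_Mapping.lookup (initial_form w f) m * c m)"
    unfolding pairing_def using keys_initial_form by (intro sum.mono_neutral_left) (auto simp: in_keys_iff)
  also have "\<dots> = pairing d f"
    unfolding pairing_def
  proof (rule sum.cong[OF refl])
    fix m assume m: "m \<in> Poly_Mapping.keys f"
    show "Poly_Mapping.lookup (initial_form w f) m * c m = Poly_Mapping.lookup f m * d m"
    proof (cases "m \<in> squarefree ` F")
      case False
      then have "c m = 0" using class_functionals_nonzero[OF c] min_indep_F by blast
      with False show ?thesis by (simp add: d_def)
    next
      case True
      then obtain A where A: "m = squarefree A" "A \<in> F" by blast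
      let ?B = "min_rep w A"
      note B = min_rep[OF A(2), of w]
      have "set_weight w A \<le> W" using W[OF m] by (simp add: A weight_squarefree)
      have "set_weight w ?B \<le> set_weight w A" using B A by (auto simp: minimizers_def)
      have d: "d m = (if set_weight w ?B = W then c (squarefree ?B) else 0)"
        using A by (simp add: d_def)
      show ?thesis
      \<comment> \<open>Since the representative weighs at most as much as \<open>A\<close>, and
        \<open>A\<close> at most \<open>W\<close>, the alternative is a representative lighter than
        \<open>W\<close>. Then \<open>d\<close> vanishes at \<open>m\<close>, and either
        \<open>A\<close> is below the top weight or it is not minimal and \<open>c\<close> vanishes
        there.\<close>
      proof (cases "set_weight w A = W \<and> set_weight w ?B = W")
        case True
        then have "A \<in> min_indep w" using B A by (intro minimizersI_le[OF B(1)]) simp_all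
        then have "c m = c (squarefree ?B)" using class_functionals_eq[OF c _ B(1), of A] B A by simp
        with True show ?thesis by (simp add: lookup[OF m] d) (simp add: A weight_squarefree)
      next
        case False
        then have "set_weight w ?B < W"
          using \<open>set_weight w ?B \<le> set_weight w A\<close> \<open>set_weight w A \<le> W\<close> by linarith
        have "c m = 0" if "set_weight w A = W"
        proof (rule ccontr)
          assume "c m \<noteq> 0"
          then have "A \<in> min_indep w" using class_functionals_nonzero[OF c] A by fastforce
          then have "set_weight w A = set_weight w ?B" using B by (intro minimizers_eq_value[of A F cl _ ?B]) simp_all
          with that \<open>set_weight w ?B < W\<close> show False by simp
        qed
        with \<open>set_weight w ?B < W\<close> show ?thesis
          by (simp add: lookup[OF m] d) (simp add: A weight_squarefree)
      qed
    qed
  qed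
  finally show "pairing c (initial_form w f) = 0" using \<open>pairing d f = 0\<close> by simp
qed

lemma initial_ideal_subset_class_ideal:
  "initial_ideal E w (J_ideal E F) \<subseteq> (class_ideal (min_indep w) :: ('e, 'k::comm_ring_1) mpoly set)"
  unfolding initial_ideal_def
proof (rule genideal_subset_ideal[OF ideal_class_ideal], clarify)
  fix f :: "('e, 'k) mpoly" assume "f \<in> J_ideal E F" "f \<noteq> 0"
  then show "initial_form w f \<in> class_ideal (min_indep w)"
    using J_ideal_subset_class_ideal by (intro initial_form_in_class_ideal) auto
qed

section \<open>Elements of the initial ideal and reduction modulo it\<close>

lemma ideal_initial_ideal:
  "ideal (initial_ideal E w (J_ideal E F) :: ('e, 'k::comm_ring_1) mpoly set) (mpoly_ring E)"
  unfolding initial_ideal_def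
proof (rule ideal_genideal_mpoly_ring, clarify)
  fix f :: "('e, 'k) mpoly" assume "f \<in> J_ideal E F"
  then have "f \<in> carrier (mpoly_ring E)" using ideal_mpoly_ringD(1)[OF ideal_J_ideal] by blast
  then show "initial_form w f \<in> carrier (mpoly_ring E)" using keys_initial_form[of w f] by auto
qed

lemma initial_form_in_initial_ideal:
  "f \<in> I \<Longrightarrow> f \<noteq> 0 \<Longrightarrow> initial_form w f \<in> initial_ideal E w I"
  unfolding initial_ideal_def by (rule subsetD[OF subset_genideal]) blast

text \<open>Either the monomial is divisible by a square, or its set is dependent, or it is the
  initial form of \<open>XS A - XS B\<close> for a lighter \<open>B\<close> of the same
  closure.\<close>

lemma nonminimal_monomial_in_initial_ideal:
  assumes "Poly_Mapping.keys m \<subseteq> E" "m \<notin> squarefree ` min_indep w"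
  shows "(Poly_Mapping.single m 1 :: ('e, 'k::comm_ring_1) mpoly) \<in> initial_ideal E w (J_ideal E F)"
proof (cases "\<exists>A. m = squarefree A")
  case False
  then obtain e n where en: "m = n + Poly_Mapping.single e 2" by (rule not_squarefreeE)
  have n: "Poly_Mapping.keys n \<subseteq> E" and "e \<in> E"
    using assms(1) unfolding en by (auto simp: in_keys_iff lookup_add subset_iff)
  have "initial_form w (Poly_Mapping.single (Poly_Mapping.single e 2) 1) \<in> (initial_ideal E w (J_ideal E F) :: ('e, 'k) mpoly set)"
    using X_square_in_J[OF \<open>e \<in> E\<close>] unfolding X_square
    by (rule initial_form_in_initial_ideal) (rule single_one_nonzero)
  then have "Poly_Mapping.single n 1 * Poly_Mapping.single (Poly_Mapping.single e 2) 1 \<in> (initial_ideal E w (J_ideal E F) :: ('e, 'k) mpoly set)"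
    unfolding initial_form_single by (rule ideal_mpoly_ringD(4)[OF ideal_initial_ideal single_in_carrier[OF n]])
  then show ?thesis by (simp add: mult_single en)
next
  case True
  then obtain A where m: "m = squarefree A" by blast
  with assms have A: "m = squarefree A" "A \<subseteq> E" "A \<notin> min_indep w" by auto
  show ?thesis
  proof (cases "A \<in> F")
    case False
    have "initial_form w (Poly_Mapping.single m 1) \<in> (initial_ideal E w (J_ideal E F) :: ('e, 'k) mpoly set)"
      using XS_dependent_in_J[OF A(2) False] unfolding XS_squarefree A(1)
      by (rule initial_form_in_initial_ideal) (rule single_one_nonzero)
    then show ?thesis by simp
  next
    case True
    then obtain B where B: "B \<in> F" "cl B = cl A" "set_weight w B < set_weight w A"
      using A(3) by (auto simp: minimizers_def not_le)
    then have "A \<noteq> B" by auto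
    then have "XS A - XS B \<noteq> (0 :: ('e, 'k) mpoly)"
      using keys_binomial[of "squarefree A" "squarefree B", where 'k='k] by (auto simp: XS_squarefree)
    then have "initial_form w (XS A - XS B) \<in> (initial_ideal E w (J_ideal E F) :: ('e, 'k) mpoly set)"
      using XS_diff_in_J[OF True B(1) B(2)[symmetric]] by (intro initial_form_in_initial_ideal)
    then show ?thesis
      unfolding XS_squarefree A(1) using B(3) by (subst (asm) initial_form_binomial_less) (simp_all add: weight_squarefree)
  qed
qed

lemma minimal_binomial_in_initial_ideal:
  assumes "A \<in> min_indep w" "B \<in> min_indep w" "cl A = cl B"
  shows "(XS A - XS B :: ('e, 'k::comm_ring_1) mpoly) \<in> initial_ideal E w (J_ideal E F)"
proof (cases "A = B")
  case True
  then show ?thesis using ideal_mpoly_ringD(2)[OF ideal_initial_ideal] by simp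
next
  case False
  then have "XS A - XS B \<noteq> (0 :: ('e, 'k) mpoly)"
    using keys_binomial[of "squarefree A" "squarefree B", where 'k='k] by (auto simp: XS_squarefree)
  then have "initial_form w (XS A - XS B) \<in> (initial_ideal E w (J_ideal E F) :: ('e, 'k) mpoly set)"
    using XS_diff_in_J[of A B] assms min_indep_F by (intro initial_form_in_initial_ideal) auto
  moreover have "set_weight w B = set_weight w A" using minimizers_eq_value[OF assms] by simp
  ultimately show ?thesis
    unfolding XS_squarefree by (subst (asm) initial_form_binomial_eq) (simp_all add: weight_squarefree)
qed

text \<open>Modulo the initial ideal each monomial reduces either to the representative of its class
  or to 0. The coefficients of the reduced form of \<open>g\<close> are values of class functionals
  on \<open>g\<close>, so this form is 0.\<close>

lemma class_ideal_subset_initial_ideal: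
  "(class_ideal (min_indep w) :: ('e, 'k::comm_ring_1) mpoly set) \<subseteq> initial_ideal E w (J_ideal E F)"
proof
  fix g :: "('e, 'k) mpoly" assume g: "g \<in> class_ideal (min_indep w)"
  let ?I = "initial_ideal E w (J_ideal E F) :: ('e, 'k) mpoly set"
  let ?r = "\<lambda>m. squarefree (min_rep w (Poly_Mapping.keys m))"
  define N :: "('e \<Rightarrow>\<^sub>0 nat) \<Rightarrow> 'k \<Rightarrow> ('e, 'k) mpoly"
    where "N m a = (if m \<in> squarefree ` min_indep w then Poly_Mapping.single (?r m) a else 0)" for m a
  have diff_in: "Poly_Mapping.single m a - N m a \<in> ?I" if m: "Poly_Mapping.keys m \<subseteq> E" for m a
  proof -
    have "Poly_Mapping.single m 1 - N m 1 \<in> ?I"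
    proof (cases "m \<in> squarefree ` min_indep w")
      case True
      then obtain A where A: "m = squarefree A" "A \<in> min_indep w" by blast
      then show ?thesis
        using minimal_binomial_in_initial_ideal[OF A(2), of "min_rep w A", where 'k='k] min_rep[OF min_indep_F[OF A(2)], of w]
        by (simp add: N_def XS_squarefree)
    next
      case False
      then show ?thesis using nonminimal_monomial_in_initial_ideal[OF m False, where 'k='k] by (simp add: N_def)
    qed
    then have "Poly_Mapping.single 0 a * (Poly_Mapping.single m 1 - N m 1) \<in> ?I"
      by (rule ideal_mpoly_ringD(4)[OF ideal_initial_ideal single_in_carrier, rotated]) simp
    then show ?thesis by (simp add: N_def mult_single right_diff_distrib split: if_splits)
  qed
  have "(\<Sum>m\<in>Poly_Mapping.keys g. N m (Poly_Mapping.lookup g m)) = 0"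
  proof (rule poly_mapping_eqI)
    fix n
    \<comment> \<open>Pairing with \<open>d\<close> reads off the coefficient at \<open>n\<close> of
      the reduced form.\<close>
    define d :: "('e \<Rightarrow>\<^sub>0 nat) \<Rightarrow> 'k"
      where "d m = (if m \<in> squarefree ` min_indep w \<and> n = ?r m then 1 else 0)" for m
    have "d \<in> class_functionals (min_indep w)"
      unfolding class_functionals_def
    proof (intro CollectI conjI allI impI ballI)
      show "m \<in> squarefree ` min_indep w" if "d m \<noteq> 0" for m
        using that by (auto simp: d_def split: if_splits)
      show "d (squarefree A) = d (squarefree B)"
        if "A \<in> min_indep w" "B \<in> min_indep w" "cl A = cl B" for A B
        using that min_rep_cong[OF that(3)] by (simp add: d_def)
    qed
    then have "pairing d g = 0" using g by (simp add: class_ideal_def)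
    moreover have "Poly_Mapping.lookup (N m a) n = a * d m" for m a
      by (simp add: N_def d_def lookup_single when_def)
    ultimately show "Poly_Mapping.lookup (\<Sum>m\<in>Poly_Mapping.keys g. N m (Poly_Mapping.lookup g m)) n
        = Poly_Mapping.lookup 0 n"
      by (simp add: lookup_sum pairing_def)
  qed
  then have "g = (\<Sum>m\<in>Poly_Mapping.keys g. Poly_Mapping.single m (Poly_Mapping.lookup g m) - N m (Poly_Mapping.lookup g m))"
    using poly_mapping_sum_singles[of g] by (simp add: sum_subtractf)
  also have "\<dots> \<in> ?I"
    using g by (intro ideal_mpoly_ring_sum[OF ideal_initial_ideal] diff_in) (simp add: class_ideal_def)
  finally show "g \<in> ?I" .
qed

lemma initial_ideal_eq_class_ideal:
  "initial_ideal E w (J_ideal E F) = (class_ideal (min_indep w) :: ('e, 'k::comm_ring_1) mpoly set)"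
  using initial_ideal_subset_class_ideal class_ideal_subset_initial_ideal by (rule equalityI)

text \<open>Recovers the family \<open>N\<close>, within \<open>F\<close>, from its ideal.\<close>

lemma XS_in_class_ideal_iff:
  assumes "A \<in> F"
  shows "(XS A :: ('e, 'k::comm_ring_1) mpoly) \<in> class_ideal N \<longleftrightarrow> A \<notin> N"
proof -
  have "XS A \<in> carrier (mpoly_ring E :: ('e, 'k) mpoly ring)"
    unfolding XS_squarefree using indep_subset[OF assms] by (intro single_in_carrier) simp
  then have iff: "(XS A :: ('e, 'k) mpoly) \<in> class_ideal N \<longleftrightarrow> (\<forall>c\<in>class_functionals N. c (squarefree A) = (0::'k))"
    by (simp add: class_ideal_def XS_squarefree)
  \<comment> \<open>The indicator of the closure class of \<open>A\<close> within \<open>N\<close>;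
    it detects \<open>XS A\<close> when \<open>A\<close> is in \<open>N\<close>.\<close>
  let ?c = "\<lambda>m. if \<exists>B\<in>N. m = squarefree B \<and> cl B = cl A then 1 else (0::'k)"
  have "?c \<in> class_functionals N" by (auto simp: class_functionals_def)
  then have "A \<in> N \<Longrightarrow> XS A \<notin> (class_ideal N :: ('e, 'k) mpoly set)"
    unfolding iff by (intro notI) (drule (1) bspec, auto)
  moreover have "A \<notin> N \<Longrightarrow> XS A \<in> (class_ideal N :: ('e, 'k) mpoly set)"
    unfolding iff using class_functionals_nonzero by fastforce
  ultimately show ?thesis by blast
qed

lemma initial_ideal_eq_iff:
  "(initial_ideal E l (J_ideal E F) :: ('e, 'k::comm_ring_1) mpoly set) = initial_ideal E w (J_ideal E F)
     \<longleftrightarrow> min_indep l = min_indep w"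
proof
  assume eq: "(initial_ideal E l (J_ideal E F) :: ('e, 'k) mpoly set) = initial_ideal E w (J_ideal E F)"
  have "A \<in> min_indep l \<longleftrightarrow> A \<in> min_indep w" if "A \<in> F" for A
    using eq XS_in_class_ideal_iff[OF that, where 'k='k] unfolding initial_ideal_eq_class_ideal by blast
  then show "min_indep l = min_indep w" using min_indep_F by blast
qed (simp add: initial_ideal_eq_class_ideal)

lemma subspace_RE: "subspace (RE E)"
  by (auto simp: subspace_def RE_def)

sublocale fan: minimizer_fan F "matroid_closure E F" set_weight "RE E"
  by (rule minimizer_fan.intro) (rule finite_F linear_set_weight subspace_RE)+

lemma groebner_cone_eq:
  "w \<in> RE E \<Longrightarrow> groebner_cone E (J_ideal E F :: ('e, 'k::comm_ring_1) mpoly set) w = fan.min_cone w"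
  unfolding groebner_cone_def initial_ideal_eq_iff by (rule fan.closure_Min_at_eq)

section \<open>The tropical hypersurface\<close>

lemma trop_basis_poly_eq:
  "trop (basis_poly F :: ('e, 'k::comm_ring_1) mpoly) w = Max (set_weight w ` bases F)"
  using trop_basis_poly[OF matroid_axioms, where 'k='k, of w]
  by (simp add: set_weight_def setcompr_eq_image)

lemma finite_bases: "finite (bases F)"
  by (rule finite_subset[OF _ finite_F]) (auto simp: bases_def)

lemma bases_F: "B \<in> bases F \<Longrightarrow> B \<in> F"
  by (simp add: bases_def)

lemma set_weight_le_trop:
  "B \<in> bases F \<Longrightarrow> set_weight w B \<le> trop (basis_poly F :: ('e, 'k::comm_ring_1) mpoly) w"
  unfolding trop_basis_poly_eq using finite_bases by simp

lemma trop_eq_set_weight: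
  assumes "B \<in> bases F" "\<And>B'. B' \<in> bases F \<Longrightarrow> set_weight w B' \<le> set_weight w B"
  shows "trop (basis_poly F :: ('e, 'k::comm_ring_1) mpoly) w = set_weight w B"
  unfolding trop_basis_poly_eq using assms finite_bases by (intro Max_eqI) auto

text \<open>The finitely many strict inequalities persist on a neighbourhood of \<open>w\<close>,
  where the function agrees with the linear form of \<open>B\<close>.\<close>

lemma smooth_at_unique_maximum:
  assumes "w \<in> RE E" "B \<in> bases F"
    and max: "\<And>B'. B' \<in> bases F \<Longrightarrow> B' \<noteq> B \<Longrightarrow> set_weight w B' < set_weight w B"
  shows "smooth_at E (trop (basis_poly F :: ('e, 'k::comm_ring_1) mpoly)) w"
proof -
  define U where "U = RE E \<inter> (\<Inter>B'\<in>bases F - {B}. {x. set_weight x B' < set_weight x B})"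
  \<comment> \<open>The iterated derivatives of a linear form: the form itself, then its constant
    0-1 coefficients for lists of length one, then 0.\<close>
  define D :: "'e list \<Rightarrow> real ^ 'e \<Rightarrow> real" where
    "D es x = (case es of [] \<Rightarrow> set_weight x B | e # es' \<Rightarrow> if es' = [] \<and> e \<in> B then 1 else 0)" for es x
  have "open {x. set_weight x B' < set_weight x B}" for B'
    using linear_set_weight
    by (intro open_Collect_less linear_continuous_on linear_conv_bounded_linear[THEN iffD1])
  then have "openin (top_of_set (RE E)) U"
    unfolding U_def using finite_bases by (intro openin_open_Int open_INT) auto
  moreover have "w \<in> U" using assms by (auto simp: U_def)
  moreover have "D [] x = trop (basis_poly F :: ('e, 'k) mpoly) x" if "x \<in> U" for x
  proof -
    have "set_weight x B' \<le> set_weight x B" if "B' \<in> bases F" for B'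
      using \<open>x \<in> U\<close> that by (cases "B' = B") (auto simp: U_def less_imp_le)
    with assms(2) have "trop (basis_poly F :: ('e, 'k) mpoly) x = set_weight x B"
      by (rule trop_eq_set_weight)
    then show ?thesis by (simp add: D_def)
  qed
  moreover have "(D es has_derivative (\<lambda>h. \<Sum>e\<in>E. h $ e * D (e # es) x)) (at x within U)" for es x
  proof (cases es)
    case Nil
    have "(\<Sum>e\<in>E. h $ e * D (e # es) x) = set_weight h B" for h
      using indep_subset[OF bases_F[OF assms(2)]] finite_ground unfolding set_weight_def
      by (intro sum.mono_neutral_cong_right) (auto simp: D_def Nil)
    moreover have "D es = (\<lambda>x. set_weight x B)" by (simp add: D_def Nil fun_eq_iff)
    ultimately show ?thesis
      using linear_set_weight
      by (auto simp: linear_conv_bounded_linear intro: bounded_linear_imp_has_derivative)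
  next
    case (Cons e es')
    have "D es = (\<lambda>_. if es' = [] \<and> e \<in> B then 1 else 0)" by (simp add: D_def Cons fun_eq_iff)
    moreover have "(\<Sum>e\<in>E. h $ e * D (e # es) x) = 0" for h by (simp add: D_def Cons)
    ultimately show ?thesis by simp
  qed
  ultimately show ?thesis unfolding smooth_at_def by blast
qed

text \<open>In the direction of an element of one maximal basis outside another one, the function has
  right slope at least 1 and left slope at most 0.\<close>

lemma not_smooth_at_two_maxima:
  assumes "w \<in> RE E" "A \<in> bases F" "B \<in> bases F" "A \<noteq> B"
    and A: "set_weight w A = trop (basis_poly F :: ('e, 'k::comm_ring_1) mpoly) w"
    and B: "set_weight w B = trop (basis_poly F :: ('e, 'k) mpoly) w"
  shows "\<not> smooth_at E (trop (basis_poly F :: ('e, 'k) mpoly)) w"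
proof
  let ?f = "trop (basis_poly F :: ('e, 'k) mpoly)"
  assume "smooth_at E ?f w"
  then obtain U D where U: "openin (top_of_set (RE E)) U" "w \<in> U" and D: "\<forall>x\<in>U. D [] x = ?f x"
    and deriv: "\<forall>es\<in>lists E. \<forall>x\<in>U. (D es has_derivative (\<lambda>h. \<Sum>e\<in>E. h $ e * D (e # es) x)) (at x within U)"
    unfolding smooth_at_def by blast
  \<comment> \<open>Distinct bases are maximal, so neither contains the other.\<close>
  obtain b where b: "b \<in> A" "b \<notin> B" using assms(2-4) by (auto simp: bases_def)
  then have "b \<in> E" using indep_subset[OF bases_F[OF assms(2)]] by blast
  define \<gamma> where "\<gamma> t = w + t *\<^sub>R axis b (1::real)" for t
  have "\<gamma> 0 = w" by (simp add: \<gamma>_def)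
  have \<gamma>_RE: "\<gamma> t \<in> RE E" for t
    using assms(1) \<open>b \<in> E\<close> by (auto simp: \<gamma>_def RE_def axis_def)
  obtain V where V: "open V" "U = RE E \<inter> V" using U(1) by (auto simp: openin_open)
  define T where "T = \<gamma> -` V"
  have T: "open T" "0 \<in> T"
    using V U(2) unfolding T_def by (auto simp: \<gamma>_def intro!: open_vimage continuous_intros)
  have \<gamma>_U: "\<gamma> ` T \<subseteq> U" using V \<gamma>_RE by (auto simp: T_def)
  have set_weight_\<gamma>: "set_weight (\<gamma> t) S = set_weight w S + (if b \<in> S then t else 0)" for t S
  proof -
    have "set_weight (axis b 1) S = (if b \<in> S then 1 else 0)"
      by (simp add: set_weight_def axis_def)
    then show ?thesis by (simp add: \<gamma>_def fan.phi_add fan.phi_scale)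
  qed
  define d where "d = D [b] w"
  have "(\<gamma> has_derivative (\<lambda>t. t *\<^sub>R axis b 1)) (at 0 within T)"
  proof -
    have "((\<lambda>t. w + t *\<^sub>R axis b 1) has_derivative (\<lambda>t. 0 + t *\<^sub>R axis b 1)) (at 0 within T)"
      by (intro has_derivative_add has_derivative_const has_derivative_scaleR_left has_derivative_ident)
    then show ?thesis by (simp add: \<gamma>_def[abs_def])
  qed
  moreover have "(D [] has_derivative (\<lambda>h. \<Sum>e\<in>E. h $ e * D [e] w)) (at (\<gamma> 0) within \<gamma> ` T)"
    using has_derivative_subset[OF bspec[OF bspec[OF deriv, of "[]"] U(2)] \<gamma>_U] \<open>\<gamma> 0 = w\<close> by simp
  ultimately have "((\<lambda>t. D [] (\<gamma> t)) has_derivative (\<lambda>t. \<Sum>e\<in>E. (t *\<^sub>R axis b (1::real)) $ e * D [e] w)) (at 0 within T)"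
    by (rule has_derivative_in_compose)
  moreover have "(\<Sum>e\<in>E. (t *\<^sub>R axis b (1::real)) $ e * D [e] w) = d * t" for t
    using \<open>b \<in> E\<close> finite_ground
    by (subst sum.mono_neutral_cong_right[of E "{b}" _ "\<lambda>_. d * t"]) (auto simp: axis_def d_def)
  ultimately have "((\<lambda>t. D [] (\<gamma> t)) has_real_derivative d) (at 0 within T)"
    by (simp add: has_field_derivative_def mult_commute_abs)
  then have "((\<lambda>t. D [] (\<gamma> t)) has_real_derivative d) (at 0)"
    using at_within_open[OF T(2,1)] by simp
  moreover have "D [] (\<gamma> t) = ?f (\<gamma> t)" if "t \<in> T" for t using D \<gamma>_U that by blast
  ultimately have d: "((\<lambda>t. ?f (\<gamma> t)) has_real_derivative d) (at 0)"
    by (rule has_field_derivative_transform_within_open[OF _ T])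
  \<comment> \<open>The first bound comes from \<open>A\<close>, whose weight grows with
    \<open>t\<close>, the second from \<open>B\<close>, whose weight is constant along
    \<open>\<gamma>\<close>.\<close>
  have ge: "?f w + t \<le> ?f (\<gamma> t)" "?f w \<le> ?f (\<gamma> t)" for t
    using set_weight_le_trop[OF assms(2), of "\<gamma> t", where 'k='k] set_weight_le_trop[OF assms(3), of "\<gamma> t", where 'k='k] A B b
    by (simp_all add: set_weight_\<gamma>)
  \<comment> \<open>By the two bounds, both \<open>?f (\<gamma> t)\<close> and
    \<open>?f (\<gamma> t) - t\<close> have a minimum at 0, which forces the derivative
    \<open>d\<close> to be 0 and 1. The bounds hold for all \<open>t\<close>, so the radius 1 is
    arbitrary.\<close>
  have "d = 0"
    using ge(2) by (intro DERIV_local_min[OF d, of 1]) (simp_all add: \<open>\<gamma> 0 = w\<close>)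
  moreover have "((\<lambda>t. ?f (\<gamma> t) - t) has_real_derivative d - 1) (at 0)"
    by (intro DERIV_diff d DERIV_ident)
  then have "d - 1 = 0"
    using ge(1) by (intro DERIV_local_min[of "\<lambda>t. ?f (\<gamma> t) - t" "d - 1" 0 1]) (auto simp: \<open>\<gamma> 0 = w\<close> algebra_simps)
  ultimately show False by simp
qed

text \<open>Negating the weight exchanges minima and maxima, and the closure class of
  \<open>B\<close> is the set of all bases.\<close>

lemma basis_min_indep_iff:
  assumes "B \<in> bases F"
  shows "B \<in> min_indep (- w) \<longleftrightarrow> (\<forall>B'\<in>bases F. set_weight w B' \<le> set_weight w B)"
proof -
  have neg: "set_weight (- w) A = - set_weight w A" for A by (simp add: set_weight_def sum_negf)
  have "B \<in> min_indep (- w) \<longleftrightarrow> (\<forall>b. b \<in> F \<and> cl b = cl B \<longrightarrow> set_weight w b \<le> set_weight w B)"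
    using bases_F[OF assms] by (auto simp: minimizers_def neg)
  moreover have "b \<in> F \<and> cl b = cl B \<longleftrightarrow> b \<in> bases F" for b
    using assms bases_F closure_basis_iff by blast
  ultimately show ?thesis by (simp only: Ball_def)
qed

section \<open>The subcomplex of cones with tied bases\<close>

definition many_min_bases :: "real ^ 'e \<Rightarrow> bool" where
  "many_min_bases v \<longleftrightarrow> (\<exists>A\<in>bases F. \<exists>B\<in>bases F. A \<noteq> B \<and> A \<in> min_indep v \<and> B \<in> min_indep v)"

lemma many_min_bases_cone: "many_min_bases v \<Longrightarrow> l \<in> fan.min_cone v \<Longrightarrow> many_min_bases l"
  unfolding many_min_bases_def fan.min_cone_def by blast

lemma trop_hypersurface_basis_poly:
  "trop_hypersurface E (basis_poly F :: ('e, 'k::comm_ring_1) mpoly) = {w \<in> RE E. many_min_bases (- w)}"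
proof -
  have "smooth_at E (trop (basis_poly F :: ('e, 'k) mpoly)) w \<longleftrightarrow> \<not> many_min_bases (- w)" if w: "w \<in> RE E" for w
  proof
    assume smooth: "smooth_at E (trop (basis_poly F :: ('e, 'k) mpoly)) w"
    show "\<not> many_min_bases (- w)"
    proof
      assume "many_min_bases (- w)"
      then obtain A B where AB: "A \<in> bases F" "B \<in> bases F" "A \<noteq> B" "A \<in> min_indep (- w)" "B \<in> min_indep (- w)"
        unfolding many_min_bases_def by blast
      show False
        using not_smooth_at_two_maxima[OF w AB(1-3), where 'k='k] smooth AB(4,5)
          trop_eq_set_weight[OF AB(1), of w, where 'k='k] trop_eq_set_weight[OF AB(2), of w, where 'k='k]
        unfolding basis_min_indep_iff[OF AB(1)] basis_min_indep_iff[OF AB(2)] by simp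
    qed
  next
    assume unique: "\<not> many_min_bases (- w)"
    have "Max (set_weight w ` bases F) \<in> set_weight w ` bases F"
      using finite_bases bases_nonempty by (intro Max_in) auto
    then obtain B where B: "B \<in> bases F" "set_weight w B = Max (set_weight w ` bases F)" by auto
    then have B_max: "\<forall>B'\<in>bases F. set_weight w B' \<le> set_weight w B" using finite_bases by simp
    have "set_weight w B' < set_weight w B" if B': "B' \<in> bases F" "B' \<noteq> B" for B'
    proof (rule ccontr)
      assume "\<not> ?thesis"
      then have "\<forall>B''\<in>bases F. set_weight w B'' \<le> set_weight w B'" using B_max by force
      with B_max B' B(1) unique show False
        unfolding many_min_bases_def using basis_min_indep_iff by blast
    qed
    then show "smooth_at E (trop (basis_poly F :: ('e, 'k) mpoly)) w"
      by (rule smooth_at_unique_maximum[OF w B(1)])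
  qed
  then show ?thesis by (auto simp: trop_hypersurface_def)
qed

text \<open>\<open>C\<close> consists of the negated cones of the weights with two minimal bases. A
  nonempty face of the cone of \<open>v\<close> is the cone of some \<open>l\<close> in it, and
  \<open>l\<close> inherits the two minimal bases.\<close>

lemma trop_hypersurface_subcomplex:
  "\<exists>C. subcomplex C (neg_fan (groebner_fan E (J_ideal E F :: ('e, 'k::comm_ring_1) mpoly set)))
     \<and> trop_hypersurface E (basis_poly F :: ('e, 'k) mpoly) = \<Union>C"
proof (intro exI conjI)
  let ?V = "{v \<in> RE E. many_min_bases v}"
  let ?C = "(\<lambda>v. uminus ` fan.min_cone v) ` ?V"
  have neg_fan: "neg_fan (groebner_fan E (J_ideal E F :: ('e, 'k) mpoly set)) = (\<lambda>v. uminus ` fan.min_cone v) ` RE E"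
    unfolding neg_fan_def groebner_fan_def image_image
    by (rule image_cong) (simp_all add: groebner_cone_eq)
  show "subcomplex ?C (neg_fan (groebner_fan E (J_ideal E F :: ('e, 'k) mpoly set)))"
    unfolding subcomplex_def neg_fan
  proof (intro conjI ballI allI impI)
    fix \<sigma> \<tau> assume "\<sigma> \<in> ?C" and \<tau>: "\<tau> face_of \<sigma> \<and> \<tau> \<noteq> {}"
    then obtain v where v: "v \<in> ?V" "\<sigma> = uminus ` fan.min_cone v" by blast
    \<comment> \<open>Negation is an injective linear involution, so faces of the negated cone
      correspond to faces of the cone.\<close>
    have "uminus ` uminus ` \<tau> face_of uminus ` fan.min_cone v"
      using \<tau> v(2) by (simp add: image_image)
    then have "uminus ` \<tau> face_of fan.min_cone v"
      by (subst (asm) face_of_linear_image) (simp_all add: linear_uminus inj_def)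
    then obtain l where l: "l \<in> fan.min_cone v" "uminus ` \<tau> = fan.min_cone l"
      using fan.face_of_min_cone \<tau> by blast
    then have "l \<in> ?V" using v(1) many_min_bases_cone by (auto simp: fan.min_cone_def)
    moreover have "\<tau> = uminus ` fan.min_cone l"
      unfolding l(2)[symmetric] by (simp add: image_image)
    ultimately show "\<tau> \<in> ?C" by blast
  qed blast
  show "trop_hypersurface E (basis_poly F :: ('e, 'k) mpoly) = \<Union>?C"
    unfolding trop_hypersurface_basis_poly
  proof (intro equalityI subsetI)
    fix w assume "w \<in> {w \<in> RE E. many_min_bases (- w)}"
    then have "- w \<in> ?V" "- w \<in> fan.min_cone (- w)"
      using subspace_neg[OF subspace_RE] by (auto simp: fan.min_cone_def)
    then show "w \<in> \<Union>?C" by (intro UN_I[of "- w"] image_eqI[of w uminus "- w"]) simp_all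
  next
    fix w assume "w \<in> \<Union>?C"
    then obtain v l where "v \<in> ?V" "l \<in> fan.min_cone v" "w = - l" by blast
    then show "w \<in> {w \<in> RE E. many_min_bases (- w)}"
      using many_min_bases_cone subspace_neg[OF subspace_RE] by (auto simp: fan.min_cone_def)
  qed
qed

end

theorem corollary6p4:
  fixes E :: "'e::finite set" and F :: "'e set set"
  assumes "matroid E F"
  shows "\<exists>C. subcomplex C (neg_fan (groebner_fan E (J_ideal E F :: ('e, 'k::field_char_0) mpoly set)))
           \<and> trop_hypersurface E (basis_poly F :: ('e, 'k) mpoly) = \<Union>C"
proof -
  interpret finite_type_matroid E F using assms by (rule finite_type_matroid.intro)
  show ?thesis by (rule trop_hypersurface_subcomplex)
qed

end
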